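(* Let $p$ be a prime, $\Bbbk$ a field of characteristic $p$, and $G=Z_{p^r}$ a cyclic group of order $p^r$ with generator $\sigma$. Let $V=\bigoplus_{i=0}^k V_{n_i}$ with $1\le n_i\le p^r$, where $V_{n}$ denotes the indecomposable $\Bbbk G$-module of dimension $n$ on which $\sigma^{-1}$ acts by a single Jordan block with ones on the diagonal. For $0\le i\le k$ let $x_i=x_{n_i,i}$ be the terminal variable of the $i$-th summand described in the context, let $X_i$ be its image in $\Bbbk[V]_G$, and let $a_i$ be the largest integer such that $n_i>p^{a_i-1}$. Then there is an isomorphism of $\Bbbk$-algebras $$\Bbbk[X_0,\ldots,X_k]\cong\Bbbk[t_0,\ldots,t_k]/(t_0^{p^{a_0}},\ldots,t_k^{p^{a_k}}),$$ where $t_0,\ldots,t_k$ are independent variables and $\Bbbk[X_0,\ldots,X_k]$ denotes the subalgebra of $\Bbbk[V]_G$ generated by $X_0,\ldots,X_k$. Moreover, $\Bbbk[V]_G$ is free as a module over $\Bbbk[X_0,\ldots,X_k]$.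
   Context: $\Bbbk[V]=S(V^* )$ with $G$ acting by $\sigma(f)=f\circ\sigma^{-1}$; $\mathcal{H}=\Bbbk[V]^G_+\Bbbk[V]$ is the Hilbert ideal, generated by homogeneous invariants of positive degree, and $\Bbbk[V]_G=\Bbbk[V]/\mathcal{H}$ is the algebra of coinvariants. Each summand $V_{n_i}$ has a basis $e_{1,i},\ldots,e_{n_i,i}$ with $\sigma^{-1}(e_{j,i})=e_{j,i}+e_{j+1,i}$ for $1\le j<n_i$ and $\sigma^{-1}(e_{n_i,i})=e_{n_i,i}$. Let $x_{1,i},\ldots,x_{n_i,i}$ be the corresponding dual basis of $V_{n_i}^*$, so that $\Bbbk[V]=\Bbbk[x_{j,i}\mid 1\le j\le n_i,\ 0\le i\le k]$ and $\sigma(x_{j,i})=x_{j,i}+x_{j-1,i}$ for $1<j\le n_i$, $\sigma(x_{1,i})=x_{1,i}$. The variables $x_i:=x_{n_i,i}$ are terminal variables, meaning that the span of all the other variables is a $\Bbbk G$-submodule of $V^*$. *)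

theory Defs
  imports "HOL-Algebra.Algebra" "HOL-Library.Poly_Mapping"
begin

section \<open>Polynomial rings\<close>

text \<open>Polynomials over \<open>'k\<close> in variables from \<open>'x\<close>: finitely supported families of coefficients
  indexed by exponent vectors.\<close>

type_synonym ('x, 'k) mpoly = "('x \<Rightarrow>\<^sub>0 nat) \<Rightarrow>\<^sub>0 'k"

definition Const :: "'k::comm_ring_1 \<Rightarrow> ('x, 'k) mpoly" where
  "Const c = Poly_Mapping.single 0 c"

definition Var :: "'x \<Rightarrow> ('x, 'k::comm_ring_1) mpoly" where
  "Var x = Poly_Mapping.single (Poly_Mapping.single x 1) 1"

definition mpoly_ring :: "'x set \<Rightarrow> ('x, 'k::comm_ring_1) mpoly ring" where
  "mpoly_ring I = \<lparr>carrier = {f. \<forall>m\<in>Poly_Mapping.keys f. Poly_Mapping.keys m \<subseteq> I},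
     monoid.mult = (*), monoid.one = 1, ring.zero = 0, ring.add = (+)\<rparr>"

definition homogeneous :: "nat \<Rightarrow> ('x, 'k::comm_ring_1) mpoly \<Rightarrow> bool" where
  "homogeneous d f \<longleftrightarrow>
     (\<forall>m\<in>Poly_Mapping.keys f. (\<Sum>x\<in>Poly_Mapping.keys m. Poly_Mapping.lookup m x) = d)"

definition poly_subst :: "('x \<Rightarrow> ('y, 'k) mpoly) \<Rightarrow> ('x, 'k::comm_ring_1) mpoly \<Rightarrow> ('y, 'k) mpoly" where
  "poly_subst s f = (\<Sum>m\<in>Poly_Mapping.keys f. Const (Poly_Mapping.lookup f m) *
     (\<Prod>x\<in>Poly_Mapping.keys m. s x ^ Poly_Mapping.lookup m x))"

lemma mpoly_ring_cring: "cring (mpoly_ring I :: ('x, 'k::comm_ring_1) mpoly ring)"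
proof -
  let ?P = "\<lambda>f::('x,'k) mpoly. \<forall>m\<in>Poly_Mapping.keys f. Poly_Mapping.keys m \<subseteq> I"
  have add: "?P (f + g)" if "?P f" "?P g" for f g
    using that Poly_Mapping.keys_add[of f g] by blast
  have mult: "?P (f * g)" if "?P f" "?P g" for f g
  proof
    fix m assume "m \<in> Poly_Mapping.keys (f * g)"
    then obtain a b where m: "m = a + b" and ab: "a \<in> Poly_Mapping.keys f" "b \<in> Poly_Mapping.keys g"
      using keys_mult[of f g] by blast
    show "Poly_Mapping.keys m \<subseteq> I"
      using Poly_Mapping.keys_add[of a b] that ab unfolding m by blast
  qed
  let ?R = "mpoly_ring I :: ('x,'k) mpoly ring"
  have R: "carrier ?R = Collect ?P" "add ?R = (+)" "monoid.mult ?R = (*)"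
      "\<zero>\<^bsub>?R\<^esub> = 0" "\<one>\<^bsub>?R\<^esub> = 1"
    by (simp_all add: mpoly_ring_def)
  define S where "S = Collect ?P"
  have S: "f + g \<in> S" "f * g \<in> S" if "f \<in> S" "g \<in> S" for f g
    using add[of f g] mult[of f g] that unfolding S_def mem_Collect_eq by fast+
  have S_minus: "- f \<in> S" if "f \<in> S" for f
    using that unfolding S_def by simp
  have S0: "0 \<in> S" "1 \<in> S" by (simp_all add: S_def)
  note R = R[folded S_def]
  have "abelian_group ?R"
  proof (rule abelian_groupI, unfold R)
    fix x y z assume xyz: "x \<in> S" "y \<in> S" "z \<in> S"
    show "x + y \<in> S" using xyz(1,2) by (rule S)
    show "x + y + z = x + (y + z)" by (rule add.assoc)
  next
    fix x y :: "('x,'k) mpoly"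
    show "x + y = y + x" by (rule add.commute)
  next
    fix x assume "x \<in> S"
    then show "\<exists>y\<in>S. y + x = 0" using S_minus by (intro bexI[of _ "- x"]) simp_all
  qed (use S S0 in simp_all)
  moreover have "Group.comm_monoid ?R"
    by (rule Group.comm_monoidI, unfold R) (use S S0 in \<open>simp_all add: mult.assoc mult.commute\<close>)
  ultimately show ?thesis
    by (rule cringI) (simp add: R distrib_right)
qed


section \<open>Algebras and free modules\<close>

text \<open>A \<open>'k\<close>-algebra is a ring together with its structure map from \<open>'k\<close>.\<close>

definition alg_isomorphic ::
    "('a, 'c) ring_scheme \<Rightarrow> ('k \<Rightarrow> 'a) \<Rightarrow> ('b, 'd) ring_scheme \<Rightarrow> ('k \<Rightarrow> 'b) \<Rightarrow> bool" where
  "alg_isomorphic R \<iota> S \<kappa> \<longleftrightarrow> (\<exists>h\<in>ring_iso R S. \<forall>c. h (\<iota> c) = \<kappa> c)"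

definition generate_alg :: "('a, 'c) ring_scheme \<Rightarrow> ('k \<Rightarrow> 'a) \<Rightarrow> 'a set \<Rightarrow> 'a set" where
  "generate_alg R \<iota> S = generate_ring R (\<iota> ` UNIV \<union> S)"

definition module_basis ::
    "('r, 'c) ring_scheme \<Rightarrow> ('r, 'a, 'd) module_scheme \<Rightarrow> 'a set \<Rightarrow> bool" where
  "module_basis R M B \<longleftrightarrow> B \<subseteq> carrier M \<and>
     (\<forall>y\<in>carrier M. \<exists>!c. c \<in> B \<rightarrow>\<^sub>E carrier R \<and> finite {b\<in>B. c b \<noteq> \<zero>\<^bsub>R\<^esub>} \<and>
        y = (\<Oplus>\<^bsub>M\<^esub>b\<in>{b\<in>B. c b \<noteq> \<zero>\<^bsub>R\<^esub>}. c b \<odot>\<^bsub>M\<^esub> b))"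

definition free_module :: "('r, 'c) ring_scheme \<Rightarrow> ('r, 'a, 'd) module_scheme \<Rightarrow> bool" where
  "free_module R M \<longleftrightarrow> Module.module R M \<and> (\<exists>B. module_basis R M B)"

definition regular_module :: "('a, 'c) ring_scheme \<Rightarrow> ('a, 'a) module" where
  "regular_module R = \<lparr>carrier = carrier R, monoid.mult = monoid.mult R, monoid.one = monoid.one R,
     ring.zero = ring.zero R, ring.add = ring.add R, smult = monoid.mult R\<rparr>"


section \<open>Coinvariants of a representation\<close>

text \<open>Throughout, \<open>scale\<close> is the scalar multiplication of the vector space \<open>V\<close> (a whole type),
  \<open>\<rho>\<close> the action of \<open>G\<close> on it, and \<open>e\<close> restricted to \<open>I\<close> a basis. The ring \<open>\<bbbk>[V] = S(V*)\<close> is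
  the polynomial ring in the dual basis, whose element dual to \<open>e b\<close> is the variable \<open>Var b\<close>.\<close>

definition coord :: "('k::field \<Rightarrow> 'v::ab_group_add \<Rightarrow> 'v) \<Rightarrow> 'x set \<Rightarrow> ('x \<Rightarrow> 'v) \<Rightarrow> 'x \<Rightarrow> 'v \<Rightarrow> 'k" where
  "coord scale I e b v = module.representation scale (e ` I) v (e b)"

text \<open>On linear forms, \<open>g \<cdot> \<phi> = \<phi> \<circ> g\<inverse>\<close>, expanded in the dual basis.\<close>

definition dual_act ::
    "('g, 'h) monoid_scheme \<Rightarrow> ('k::field \<Rightarrow> 'v::ab_group_add \<Rightarrow> 'v) \<Rightarrow> ('g \<Rightarrow> 'v \<Rightarrow> 'v) \<Rightarrow>
     'x set \<Rightarrow> ('x \<Rightarrow> 'v) \<Rightarrow> 'g \<Rightarrow> 'x \<Rightarrow> ('x, 'k) mpoly" where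
  "dual_act G scale \<rho> I e g b =
     (\<Sum>c\<in>I. Const (coord scale I e b (\<rho> (inv\<^bsub>G\<^esub> g) (e c))) * Var c)"

definition poly_act ::
    "('g, 'h) monoid_scheme \<Rightarrow> ('k::field \<Rightarrow> 'v::ab_group_add \<Rightarrow> 'v) \<Rightarrow> ('g \<Rightarrow> 'v \<Rightarrow> 'v) \<Rightarrow>
     'x set \<Rightarrow> ('x \<Rightarrow> 'v) \<Rightarrow> 'g \<Rightarrow> ('x, 'k) mpoly \<Rightarrow> ('x, 'k) mpoly" where
  "poly_act G scale \<rho> I e g = poly_subst (dual_act G scale \<rho> I e g)"

definition invariants ::
    "('g, 'h) monoid_scheme \<Rightarrow> ('k::field \<Rightarrow> 'v::ab_group_add \<Rightarrow> 'v) \<Rightarrow> ('g \<Rightarrow> 'v \<Rightarrow> 'v) \<Rightarrow>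
     'x set \<Rightarrow> ('x \<Rightarrow> 'v) \<Rightarrow> ('x, 'k) mpoly set" where
  "invariants G scale \<rho> I e =
     {f \<in> carrier (mpoly_ring I). \<forall>g\<in>carrier G. poly_act G scale \<rho> I e g f = f}"

definition hilbert_ideal ::
    "('g, 'h) monoid_scheme \<Rightarrow> ('k::field \<Rightarrow> 'v::ab_group_add \<Rightarrow> 'v) \<Rightarrow> ('g \<Rightarrow> 'v \<Rightarrow> 'v) \<Rightarrow>
     'x set \<Rightarrow> ('x \<Rightarrow> 'v) \<Rightarrow> ('x, 'k) mpoly set" where
  "hilbert_ideal G scale \<rho> I e =
     Idl\<^bsub>mpoly_ring I\<^esub> {f \<in> invariants G scale \<rho> I e. \<exists>d>0. homogeneous d f}"

definition coinvariants ::
    "('g, 'h) monoid_scheme \<Rightarrow> ('k::field \<Rightarrow> 'v::ab_group_add \<Rightarrow> 'v) \<Rightarrow> ('g \<Rightarrow> 'v \<Rightarrow> 'v) \<Rightarrow>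
     'x set \<Rightarrow> ('x \<Rightarrow> 'v) \<Rightarrow> ('x, 'k) mpoly set ring" where
  "coinvariants G scale \<rho> I e = mpoly_ring I Quot hilbert_ideal G scale \<rho> I e"

text \<open>The pair \<open>(j, i)\<close> indexes the \<open>j\<close>-th basis vector of the \<open>i\<close>-th summand.\<close>

definition jordan_index :: "nat \<Rightarrow> (nat \<Rightarrow> nat) \<Rightarrow> (nat \<times> nat) set" where
  "jordan_index k n = {(j, i). i \<le> k \<and> 1 \<le> j \<and> j \<le> n i}"

lemma coord_basis:
  assumes "vector_space scale" "inj_on e I" "\<not> module.dependent scale (e ` I)" "b \<in> I" "c \<in> I"
  shows "coord scale I e b (e c) = (if c = b then 1 else 0)"
proof -
  interpret vector_space scale by fact
  show ?thesis unfolding coord_def using assms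
    by (subst representation_basis) (auto simp: inj_on_eq_iff)
qed

lemma coord_add:
  assumes "vector_space scale" "\<not> module.dependent scale (e ` I)" "module.span scale (e ` I) = UNIV"
  shows "coord scale I e b (v + w) = coord scale I e b v + coord scale I e b w"
proof -
  interpret vector_space scale by fact
  show ?thesis unfolding coord_def using assms by (subst representation_add) auto
qed

lemma finite_jordan_index [simp]: "finite (jordan_index k n)"
proof -
  have "jordan_index k n \<subseteq> (\<Union>i\<in>{..k}. {..n i} \<times> {i})" by (auto simp: jordan_index_def)
  then show ?thesis by (rule finite_subset) auto
qed

text \<open>For \<open>V = \<Oplus>\<^sub>i V\<^bsub>n i\<^esub>\<close> this gives \<open>\<sigma>(x\<^bsub>j,i\<^esub>) = x\<^bsub>j,i\<^esub> + x\<^bsub>j-1,i\<^esub>\<close> for \<open>j > 1\<close> and \<open>\<sigma>(x\<^bsub>1,i\<^esub>) = x\<^bsub>1,i\<^esub>\<close>.\<close>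

lemma dual_act_jordan:
  fixes scale :: "'k::field \<Rightarrow> 'v::ab_group_add \<Rightarrow> 'v"
  assumes V: "vector_space scale" "inj_on e (jordan_index k n)"
      "\<not> module.dependent scale (e ` jordan_index k n)"
      "module.span scale (e ` jordan_index k n) = UNIV"
    and s: "\<And>i j. \<lbrakk>i \<le> k; 1 \<le> j; j < n i\<rbrakk> \<Longrightarrow> \<rho> (inv\<^bsub>G\<^esub> \<sigma>) (e (j, i)) = e (j, i) + e (j + 1, i)"
      "\<And>i. i \<le> k \<Longrightarrow> \<rho> (inv\<^bsub>G\<^esub> \<sigma>) (e (n i, i)) = e (n i, i)"
    and b: "(j, i) \<in> jordan_index k n"
  shows "dual_act G scale \<rho> (jordan_index k n) e \<sigma> (j, i) =
    (if 1 < j then Var (j, i) + Var (j - 1, i) else Var (j, i))"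
proof -
  let ?I = "jordan_index k n" and ?x = "coord scale (jordan_index k n) e (j, i)"
  have x: "?x (\<rho> (inv\<^bsub>G\<^esub> \<sigma>) (e c)) = (if c = (j, i) then 1 else 0) + (if c = (j - 1, i) then 1 else 0)"
    if c: "c \<in> ?I" for c
  proof -
    obtain l m where lm: "c = (l, m)" by (cases c)
    with c have r: "m \<le> k" "1 \<le> l" "l \<le> n m" by (auto simp: jordan_index_def)
    show ?thesis
    proof (cases "l = n m")
      case True
      then show ?thesis using s(2)[OF r(1)] coord_basis[OF V(1,2,3) b c] b
        unfolding lm by (auto simp: jordan_index_def)
    next
      case False
      then have c': "(l + 1, m) \<in> ?I" using r by (auto simp: jordan_index_def)
      show ?thesis using False r
        using s(1)[of m l] coord_basis[OF V(1,2,3) b c] coord_basis[OF V(1,2,3) b c'] coord_add[OF V(1,3,4)] b r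
        unfolding lm by (auto simp: jordan_index_def)
    qed
  qed
  have C: "Const 0 = (0 :: ('y,'k) mpoly)" "Const 1 = (1 :: ('y,'k) mpoly)"
    "Const (u + v) = (Const u + Const v :: ('y,'k) mpoly)" for u v
    by (simp_all add: Const_def single_add)
  have "dual_act G scale \<rho> ?I e \<sigma> (j, i) =
      (\<Sum>c\<in>?I. (if c = (j, i) then Var c else 0) + (if c = (j - 1, i) then Var c else 0))"
    unfolding dual_act_def by (rule sum.cong) (auto simp: x C distrib_right)
  also have "\<dots> = (if 1 < j then Var (j, i) + Var (j - 1, i) else Var (j, i))"
  proof -
    have "(j - 1, i) \<in> ?I \<longleftrightarrow> 1 < j" using b by (auto simp: jordan_index_def)
    then show ?thesis using b by (simp add: sum.distrib)
  qed
  finally show ?thesis .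
qed

end

(* The invariance of the span of the other variables means that translating the terminal variables
   commutes with the group, so all Taylor coefficients of an invariant in the terminal variables are
   again invariants. Expanding f(x + t) at t = -x recovers the coefficients of f as a polynomial in the
   terminal variables, and these lie in the Hilbert ideal H as soon as (a) x_i^{q_i} lies in H,
   q_i = p^{a_i}, and (b) no invariant of positive degree d contains a monomial of degree d
   in the terminal variables with all exponents below q_i. Part (a) is the same expansion applied to the
   norm of x_i. For (b) a Taylor coefficient reduces the question to a power x_i^d with d = p^s < n_i,
   which is excluded by comparing the sum of f^{p-1} over the points of the i-th block with coordinates
   in the prime field (zero by degree, as in Chevalley--Warning) with the sum over the fixed points.
   Hence H is generated by the x_i^{q_i} and polynomials in the other variables, and a basis of the
   polynomials in the other variables modulo H is a basis of the coinvariants over k[X_0, ..., X_k]. *)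

theory Submission
  imports Defs
begin

text \<open>The number q_i is the least power of p that is at least n_i, and there (a) and (b) meet:
  n_i <= q_i makes the q_i-th iterate of \<open>\<sigma>\<close> fix x_i, so the product of the
  first q_i iterates is invariant; p^s < n_i for every p^s < q_i is the degree bound of (b). That
  q_i is a power of p is used once more. In its own degree an invariant has constant Taylor
  coefficients, and those at exponents not below the q_i may be nonzero, as for the norm. They are
  harmless because (T_i - x_i)^{q_i} = T_i^{q_i} - x_i^{q_i}, with x_i^{q_i} in H. For this the
  coefficients are recovered by t = T - x, with T a fresh copy of the terminal variables; t = -x
  itself serves the norm. In (b) the field may be infinite, and only the Jordan matrix, not f, has
  its entries in the prime field. So f^{p-1} is no indicator function, but on the fixed line it
  equals (c t^d)^{p-1}, which is c^{p-1} at the p - 1 nonzero t, with sum -c^{p-1}. The reduction to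
  d = p^s works because p does not divide binom(p^s m, p^s) when p does not divide m.\<close>

abbreviation lookup :: "('a \<Rightarrow>\<^sub>0 'b::zero) \<Rightarrow> 'a \<Rightarrow> 'b" where "lookup \<equiv> Poly_Mapping.lookup"
abbreviation keys :: "('a \<Rightarrow>\<^sub>0 'b::zero) \<Rightarrow> 'a set" where "keys \<equiv> Poly_Mapping.keys"
abbreviation single :: "'a \<Rightarrow> 'b \<Rightarrow> 'a \<Rightarrow>\<^sub>0 'b::zero" where "single \<equiv> Poly_Mapping.single"

section \<open>Evaluation of polynomials\<close>

text \<open>Homomorphisms between whole types rather than carriers. Evaluation, Taylor expansion and
  the group action all have this form, so an identity between them needs checking on constants and
  variables only (\<open>ring_map_ext\<close>).\<close>

locale ring_map =
  fixes h :: "'a::comm_ring_1 \<Rightarrow> 'b::comm_ring_1"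
  assumes one [simp]: "h 1 = 1"
    and add [simp]: "h (u + v) = h u + h v"
    and mult [simp]: "h (u * v) = h u * h v"
begin

lemma zero [simp]: "h 0 = 0"
  using add[of 0 0] by simp

lemma uminus [simp]: "h (- u) = - h u"
  using add[of u "- u"] by (simp add: minus_unique)

lemma diff [simp]: "h (u - v) = h u - h v"
  using add[of u "- v"] by simp

lemma power [simp]: "h (u ^ m) = h u ^ m"
  by (induction m) simp_all

lemma sum: "h (sum g A) = (\<Sum>i\<in>A. h (g i))"
  by (induction A rule: infinite_finite_induct) simp_all

lemma prod: "h (prod g A) = (\<Prod>i\<in>A. h (g i))"
  by (induction A rule: infinite_finite_induct) simp_all

lemma of_nat [simp]: "h (of_nat m) = of_nat m"
  by (induction m) simp_all

end

lemma ring_map_comp: "ring_map f \<Longrightarrow> ring_map g \<Longrightarrow> ring_map (\<lambda>u. f (g u))"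
  by (simp add: ring_map_def)

lemma ring_map_ident: "ring_map (\<lambda>u. u)"
  by (simp add: ring_map_def)

lemma lookup_Const: "lookup (Const c) m = (if m = 0 then c else 0)"
  by (simp add: Const_def lookup_single when_def)

lemma ring_map_Const: "ring_map Const"
  by (simp add: ring_map_def Const_def single_add mult_single)

lemmas Const_simps [simp] = ring_map.one[OF ring_map_Const] ring_map.zero[OF ring_map_Const]

definition monom_eval :: "('x \<Rightarrow> 'b::comm_ring_1) \<Rightarrow> ('x \<Rightarrow>\<^sub>0 nat) \<Rightarrow> 'b" where
  "monom_eval s m = (\<Prod>x\<in>keys m. s x ^ lookup m x)"

lemma monom_eval_superset:
  assumes "finite A" "keys m \<subseteq> A"
  shows "monom_eval s m = (\<Prod>x\<in>A. s x ^ lookup m x)"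
  unfolding monom_eval_def
  by (rule prod.mono_neutral_left) (use assms in \<open>auto simp: in_keys_iff\<close>)

lemma monom_eval_0 [simp]: "monom_eval s 0 = 1"
  by (simp add: monom_eval_def)

lemma monom_eval_single [simp]: "monom_eval s (single x d) = s x ^ d"
  by (simp add: monom_eval_def)

lemma monom_eval_add [simp]: "monom_eval s (m + m') = monom_eval s m * monom_eval s m'"
proof -
  let ?A = "keys m \<union> keys m'"
  have "keys (m + m') \<subseteq> ?A" by (rule keys_add)
  then show ?thesis
    by (simp add: monom_eval_superset[of ?A] lookup_add power_add prod.distrib)
qed

lemma monom_eval_cong: "(\<And>x. x \<in> keys m \<Longrightarrow> s x = t x) \<Longrightarrow> monom_eval s m = monom_eval t m"
  unfolding monom_eval_def by (rule prod.cong) auto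

lemma (in ring_map) monom_eval: "h (monom_eval s m) = monom_eval (\<lambda>x. h (s x)) m"
  by (simp add: monom_eval_def prod)

lemma poly_mapping_sum_single: "f = (\<Sum>m\<in>keys f. single m (lookup f m))"
proof (rule poly_mapping_eqI)
  fix m
  show "lookup f m = lookup (\<Sum>m\<in>keys f. single m (lookup f m)) m"
    by (simp add: lookup_sum lookup_single when_def in_keys_iff)
qed

lemma monom_eval_Var: "monom_eval Var m = (single m 1 :: ('x, 'k::comm_ring_1) mpoly)"
proof (induction m rule: update_induct)
  case const
  then show ?case by simp
next
  case (update m x d)
  have pow: "(Var x :: ('x, 'k) mpoly) ^ d = single (single x d) 1"
    by (induction d) (simp_all add: Var_def mult_single flip: single_add)
  have *: "Poly_Mapping.update x d m = m + single x d"
    using update(1) by (intro poly_mapping_eqI)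
      (auto simp: lookup_update lookup_add lookup_single when_def in_keys_iff)
  show ?case unfolding * by (simp add: update pow mult_single)
qed

lemma single_eq_Const_monom: "single m c = Const c * monom_eval Var m"
  by (simp add: monom_eval_Var Const_def mult_single)

text \<open>The coefficient map is a parameter so that one construction covers values at points
  (identity), substitutions (\<open>Const\<close>) and polynomials over polynomials
  (\<open>Const\<close> twice).\<close>

definition peval :: "('k::comm_ring_1 \<Rightarrow> 'b::comm_ring_1) \<Rightarrow> ('x \<Rightarrow> 'b) \<Rightarrow> ('x, 'k) mpoly \<Rightarrow> 'b" where
  "peval h s f = (\<Sum>m\<in>keys f. h (lookup f m) * monom_eval s m)"

lemma poly_subst_eq_peval: "poly_subst s = peval Const s"
  by (rule ext) (simp add: poly_subst_def peval_def monom_eval_def)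

lemma peval_cong:
  "(\<And>m x. m \<in> keys f \<Longrightarrow> x \<in> keys m \<Longrightarrow> s x = t x) \<Longrightarrow> peval h s f = peval h t f"
  unfolding peval_def by (intro sum.cong refl arg_cong2[where f = "(*)"] monom_eval_cong) auto

context ring_map
begin

lemma peval_superset:
  assumes "finite A" "keys f \<subseteq> A"
  shows "peval h s f = (\<Sum>m\<in>A. h (lookup f m) * monom_eval s m)"
  unfolding peval_def by (rule sum.mono_neutral_left) (use assms in \<open>auto simp: in_keys_iff\<close>)

lemma peval_single: "peval h s (single m c) = h c * monom_eval s m"
  by (simp add: peval_def)

lemma peval_Const: "peval h s (Const c) = h c"
  by (simp add: Const_def peval_single)

lemma peval_Var: "peval h s (Var x) = s x"
  by (simp add: Var_def peval_single)

lemma peval_add: "peval h s (f + g) = peval h s f + peval h s g"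
proof -
  let ?A = "keys f \<union> keys g"
  have "keys (f + g) \<subseteq> ?A" by (rule keys_add)
  then show ?thesis
    by (simp add: peval_superset[of ?A] lookup_add distrib_right sum.distrib)
qed

lemma peval_sum: "peval h s (sum g A) = (\<Sum>i\<in>A. peval h s (g i))"
  by (induction A rule: infinite_finite_induct) (simp_all add: peval_add peval_def[of _ _ 0])

lemma peval_mult: "peval h s (f * g) = peval h s f * peval h s g"
proof -
  have "f * g = (\<Sum>m\<in>keys f. single m (lookup f m)) * (\<Sum>m\<in>keys g. single m (lookup g m))"
    by (simp flip: poly_mapping_sum_single)
  also have "\<dots> = (\<Sum>m\<in>keys f. \<Sum>m'\<in>keys g. single (m + m') (lookup f m * lookup g m'))"
    by (simp add: sum_product mult_single)
  finally show ?thesis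
    by (simp add: peval_sum peval_single peval_def[of h s f] peval_def[of h s g] sum_product ac_simps)
qed

lemma ring_map_peval: "ring_map (peval h s)"
  using peval_single[of s 0 1] by (simp add: ring_map_def peval_add peval_mult)

end

lemma lookup_single_times:
  fixes m :: "'x \<Rightarrow>\<^sub>0 nat"
  shows "lookup (single m c * f) m' =
    (if \<exists>l. m' = m + l then c * lookup f (m' - m) else (0::'k::comm_ring_1))"
proof -
  have "lookup (single m c * f) m' =
      (\<Sum>l\<in>keys f. lookup (single (m + l) (c * lookup f l)) m')"
    by (subst (1) poly_mapping_sum_single[of f]) (simp add: sum_distrib_left mult_single lookup_sum)
  also have "\<dots> = (\<Sum>l\<in>keys f. if m' = m + l then c * lookup f l else 0)"
    by (rule sum.cong) (auto simp: lookup_single when_def)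
  also have "\<dots> = (if \<exists>l. m' = m + l then c * lookup f (m' - m) else 0)"
  proof (cases "\<exists>l. m' = m + l")
    case True
    then obtain l where "m' = m + l" by auto
    then show ?thesis by (auto simp: in_keys_iff)
  qed (auto intro: sum.neutral)
  finally show ?thesis .
qed

lemma lookup_Const_times: "lookup (Const c * f) m = c * lookup f m"
  for f :: "('x, 'k::comm_ring_1) mpoly"
  by (simp add: Const_def lookup_single_times)

lemma lookup_Var_times:
  "lookup (Var x * f) m = (if 0 < lookup m x then lookup f (m - single x 1) else 0)"
  for f :: "('x, 'k::comm_ring_1) mpoly"
proof -
  have "(\<exists>l. m = single x 1 + l) \<longleftrightarrow> 0 < lookup m x"
  proof
    assume "0 < lookup m x"
    then have "m = single x 1 + (m - single x 1)"
      by (intro poly_mapping_eqI) (auto simp: lookup_add lookup_minus lookup_single when_def)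
    then show "\<exists>l. m = single x 1 + l" by blast
  qed (auto simp: lookup_add)
  then show ?thesis by (simp add: Var_def lookup_single_times)
qed

text \<open>At exponent 0 only the product of the constant terms contributes, since 0 splits only as
  0 + 0. This evaluation at the origin later keeps nonzero constants out of the Hilbert
  ideal.\<close>

lemma ring_map_lookup_0: "ring_map (\<lambda>f :: ('x, 'k::comm_ring_1) mpoly. lookup f 0)"
proof -
  have "lookup (f * g) 0 = lookup f 0 * lookup g 0" for f g :: "('x, 'k) mpoly"
  proof -
    have "f * g = (\<Sum>m\<in>keys f. single m (lookup f m) * g)"
      by (subst (1) poly_mapping_sum_single[of f]) (simp add: sum_distrib_right)
    then have "lookup (f * g) 0 = (\<Sum>m\<in>keys f. lookup (single m (lookup f m) * g) 0)"
      by (simp add: lookup_sum)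
    also have "\<dots> = (\<Sum>m\<in>keys f. if m = 0 then lookup f m * lookup g 0 else 0)"
    proof (intro sum.cong refl)
      fix m :: "'x \<Rightarrow>\<^sub>0 nat"
      have "m = 0" if "0 = m + l" for l
      proof (rule poly_mapping_eqI)
        fix x show "lookup m x = lookup 0 x"
          using arg_cong[OF that, of "\<lambda>m. lookup m x"] by (simp add: lookup_add)
      qed
      then show "lookup (single m (lookup f m) * g) 0 = (if m = 0 then lookup f m * lookup g 0 else 0)"
        by (auto simp: lookup_single_times)
    qed
    also have "\<dots> = lookup f 0 * lookup g 0"
      by (simp add: in_keys_iff)
    finally show ?thesis .
  qed
  then show ?thesis by (simp add: ring_map_def lookup_add)
qed

section \<open>Polynomials in a prescribed set of variables\<close>

abbreviation polys :: "'x set \<Rightarrow> ('x, 'k::comm_ring_1) mpoly set" where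
  "polys I \<equiv> carrier (mpoly_ring I)"

lemma mem_polys_iff: "f \<in> polys I \<longleftrightarrow> (\<forall>m\<in>keys f. keys m \<subseteq> I)"
  by (simp add: mpoly_ring_def)

lemma mpoly_ring_simps [simp]:
  "add (mpoly_ring I) = (+)" "monoid.mult (mpoly_ring I) = (*)"
  "\<zero>\<^bsub>mpoly_ring I\<^esub> = 0" "\<one>\<^bsub>mpoly_ring I\<^esub> = 1"
  by (simp_all add: mpoly_ring_def)

lemma polys_add: "f \<in> polys I \<Longrightarrow> g \<in> polys I \<Longrightarrow> f + g \<in> polys I"
  using cring.cring_simprules(1)[OF mpoly_ring_cring, of f I g] by simp

lemma polys_mult: "f \<in> polys I \<Longrightarrow> g \<in> polys I \<Longrightarrow> f * g \<in> polys I"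
  using cring.cring_simprules(5)[OF mpoly_ring_cring, of f I g] by simp

lemma polys_0 [simp]: "0 \<in> polys I"
  by (simp add: mem_polys_iff)

lemma polys_1 [simp]: "1 \<in> polys I"
  by (simp add: mem_polys_iff)

lemma polys_uminus: "f \<in> polys I \<Longrightarrow> - f \<in> polys I"
  by (simp add: mem_polys_iff)

lemma polys_diff: "f \<in> polys I \<Longrightarrow> g \<in> polys I \<Longrightarrow> f - g \<in> polys I"
  using polys_add[OF _ polys_uminus, of f I g] by simp

lemma polys_sum: "(\<And>i. i \<in> A \<Longrightarrow> g i \<in> polys I) \<Longrightarrow> sum g A \<in> polys I"
  by (induction A rule: infinite_finite_induct) (simp_all add: polys_add)

lemma polys_prod: "(\<And>i. i \<in> A \<Longrightarrow> g i \<in> polys I) \<Longrightarrow> prod g A \<in> polys I"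
  by (induction A rule: infinite_finite_induct) (simp_all add: polys_mult)

lemma polys_power: "f \<in> polys I \<Longrightarrow> f ^ m \<in> polys I"
  by (induction m) (simp_all add: polys_mult)

lemma polys_Const [simp]: "Const c \<in> polys I"
  by (simp add: mem_polys_iff Const_def)

lemma polys_Var: "x \<in> I \<Longrightarrow> Var x \<in> polys I"
  by (simp add: mem_polys_iff Var_def)

lemma polys_single: "keys m \<subseteq> I \<Longrightarrow> single m c \<in> polys I"
  by (simp add: mem_polys_iff)

lemma polys_mono: "I \<subseteq> I' \<Longrightarrow> f \<in> polys I \<Longrightarrow> f \<in> polys I'"
  by (auto simp: mem_polys_iff)

lemma polys_monom_eval: "(\<And>x. x \<in> keys m \<Longrightarrow> s x \<in> polys I) \<Longrightarrow> monom_eval s m \<in> polys I"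
  unfolding monom_eval_def by (intro polys_prod polys_power)

lemma ring_map_ext:
  assumes "ring_map \<phi>" "ring_map \<psi>" "\<And>c. \<phi> (Const c) = \<psi> (Const c)"
    and "\<And>x. x \<in> I \<Longrightarrow> \<phi> (Var x) = \<psi> (Var x)" and "f \<in> polys I"
  shows "\<phi> f = \<psi> f"
proof -
  have "\<phi> (single m c) = \<psi> (single m c)" if "keys m \<subseteq> I" for m c
    using assms(3,4) that
    by (auto simp: single_eq_Const_monom ring_map.mult[OF assms(1)] ring_map.mult[OF assms(2)]
        ring_map.monom_eval[OF assms(1)] ring_map.monom_eval[OF assms(2)] subset_iff
        intro!: arg_cong2[where f = "(*)"] monom_eval_cong)
  then have "(\<Sum>m\<in>keys f. \<phi> (single m (lookup f m))) = (\<Sum>m\<in>keys f. \<psi> (single m (lookup f m)))"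
    using assms(5) by (intro sum.cong refl) (auto simp: mem_polys_iff)
  then show ?thesis
    by (subst (1 2) poly_mapping_sum_single[of f])
      (simp add: ring_map.sum[OF assms(1)] ring_map.sum[OF assms(2)])
qed

lemma polys_peval: "f \<in> polys J \<Longrightarrow> (\<And>c. h c \<in> polys I) \<Longrightarrow> (\<And>x. x \<in> J \<Longrightarrow> s x \<in> polys I) \<Longrightarrow>
    peval h s f \<in> polys I"
  unfolding peval_def by (intro polys_sum polys_mult polys_monom_eval) (auto simp: mem_polys_iff[of f])

lemma polys_induct [consumes 1, case_names Const Var add mult]:
  assumes "f \<in> polys I" "\<And>c. P (Const c)" "\<And>x. x \<in> I \<Longrightarrow> P (Var x)"
    "\<And>f g. P f \<Longrightarrow> P g \<Longrightarrow> P (f + g)" "\<And>f g. P f \<Longrightarrow> P g \<Longrightarrow> P (f * g)"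
  shows "P f"
proof -
  have P01: "P 0" "P 1" using assms(2)[of 0] assms(2)[of 1] by simp_all
  have pow: "P (Var x ^ d)" if "x \<in> I" for x d
    by (induction d) (auto simp: P01 assms that)
  have prod: "P (\<Prod>x\<in>A. Var x ^ lookup m x)" if "finite A" "A \<subseteq> I" for A m
    using that by (induction A rule: finite_induct) (auto simp: P01 assms pow)
  have "P (\<Sum>m\<in>A. single m (lookup f m))" if "finite A" "A \<subseteq> keys f" for A
    using that
  proof (induction A rule: finite_induct)
    case (insert m A)
    have "P (single m (lookup f m))"
      unfolding single_eq_Const_monom monom_eval_def
      by (intro assms prod) (use insert assms(1) in \<open>auto simp: mem_polys_iff\<close>)
    then show ?case using insert by (simp add: assms)
  qed (simp add: P01)
  then show ?thesis
    using poly_mapping_sum_single[of f] by (metis finite_keys order_refl)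
qed

section \<open>Unipotent shifts\<close>

text \<open>An orbit of \<open>\<pi>\<close> has length dividing p^r. Unless it is a fixed point, p
  divides its length and the constant values of \<open>\<phi>\<close> on it add up to 0. The
  induction removes one such orbit at a time.\<close>

lemma sum_eq_sum_fixed_points:
  fixes \<phi> :: "'b \<Rightarrow> 'a::comm_ring_1"
  assumes p: "Factorial_Ring.prime p" "of_nat p = (0::'a)" and "finite \<Omega>"
    and "\<And>x. x \<in> \<Omega> \<Longrightarrow> \<pi> x \<in> \<Omega>" "\<And>x. x \<in> \<Omega> \<Longrightarrow> (\<pi> ^^ (p ^ r)) x = x"
    and "\<And>x. x \<in> \<Omega> \<Longrightarrow> \<phi> (\<pi> x) = \<phi> x"
  shows "sum \<phi> \<Omega> = sum \<phi> {x \<in> \<Omega>. \<pi> x = x}"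
  using assms(3-)
proof (induction \<Omega> rule: finite_psubset_induct)
  case (psubset \<Omega>)
  define N where "N = p ^ r"
  have N: "0 < N" using p(1) by (simp add: N_def prime_gt_0_nat)
  show ?case
  proof (cases "\<forall>x\<in>\<Omega>. \<pi> x = x")
    case True
    then have "{x \<in> \<Omega>. \<pi> x = x} = \<Omega>" by auto
    then show ?thesis by simp
  next
    case False
    then obtain x where x: "x \<in> \<Omega>" "\<pi> x \<noteq> x" by auto
    have per: "(\<pi> ^^ N) y = y" if "y \<in> \<Omega>" for y using psubset.prems(2) that by (simp add: N_def)
    have in_\<Omega>: "(\<pi> ^^ l) y \<in> \<Omega>" if "y \<in> \<Omega>" for y l
      using that by (induction l) (auto simp: psubset.prems)
    \<comment> \<open>Minimal period of \<open>x\<close>, hence the length of its orbit. It divides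
      \<open>N\<close> and exceeds 1, so p divides it.\<close>
    define d where "d = (LEAST d. 0 < d \<and> (\<pi> ^^ d) x = x)"
    have d: "0 < d" "(\<pi> ^^ d) x = x"
      using LeastI[of "\<lambda>d. 0 < d \<and> (\<pi> ^^ d) x = x" N] N per[OF x(1)] unfolding d_def by auto
    have d_le: "d \<le> l" if "0 < l" "(\<pi> ^^ l) x = x" for l
      unfolding d_def by (rule Least_le) (use that in simp)
    have "d dvd N"
    proof (rule ccontr)
      assume "\<not> d dvd N"
      then have "0 < N mod d" by (simp add: mod_greater_zero_iff_not_dvd)
      moreover have "(\<pi> ^^ (N mod d)) x = x" using funpow_mod_eq[OF d(2), of N] per[OF x(1)] by simp
      ultimately show False using d_le[of "N mod d"] d(1) by (simp add: not_less[symmetric])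
    qed
    moreover have "d \<noteq> 1" using d x(2) by auto
    ultimately have p_dvd: "p dvd d"
      using p(1) unfolding N_def by (auto simp: divides_primepow_nat)
    define O' where "O' = (\<lambda>l. (\<pi> ^^ l) x) ` {..<d}"
    have inj: "inj_on (\<lambda>l. (\<pi> ^^ l) x) {..<d}"
    proof (rule linorder_inj_onI)
      fix i j assume ij: "i < j" "i \<in> {..<d}" "j \<in> {..<d}"
      show "(\<pi> ^^ i) x \<noteq> (\<pi> ^^ j) x"
      proof
        assume "(\<pi> ^^ i) x = (\<pi> ^^ j) x"
        then have "(\<pi> ^^ (d - j + i)) x = (\<pi> ^^ (d - j + j)) x" unfolding funpow_add by simp
        then show False using d_le[of "d - j + i"] d ij by auto
      qed
    qed auto
    have O'_\<Omega>: "O' \<subseteq> \<Omega>" unfolding O'_def using in_\<Omega>[OF x(1)] by auto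
    have O'_all: "(\<pi> ^^ l) x \<in> O'" for l
      using d(1) unfolding O'_def
      by (intro image_eqI[of _ _ "l mod d"]) (simp_all add: funpow_mod_eq[OF d(2)])
    \<comment> \<open>The complement of the orbit is stable because \<open>N - 1\<close> further
      steps lead from \<open>\<pi> y\<close> back to \<open>y\<close>.\<close>
    have closed: "\<pi> y \<in> \<Omega> - O'" if y: "y \<in> \<Omega> - O'" for y
    proof -
      have "y \<in> O'" if "\<pi> y \<in> O'"
      proof -
        obtain l where "\<pi> y = (\<pi> ^^ l) x" using \<open>\<pi> y \<in> O'\<close> unfolding O'_def by auto
        then have "(\<pi> ^^ (N - 1)) (\<pi> y) = (\<pi> ^^ (N - 1 + l)) x" unfolding funpow_add by simp
        moreover have "(\<pi> ^^ (N - 1)) (\<pi> y) = (\<pi> ^^ N) y"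
          using N by (metis Suc_diff_1 comp_apply funpow_Suc_right)
        ultimately have "y = (\<pi> ^^ (N - 1 + l)) x" using per[of y] y by simp
        then show ?thesis by (simp only: O'_all)
      qed
      then show ?thesis using y psubset.prems(1) by auto
    qed
    have "sum \<phi> O' = (\<Sum>l<d. \<phi> ((\<pi> ^^ l) x))"
      unfolding O'_def by (simp add: sum.reindex[OF inj])
    also have "\<dots> = (\<Sum>l<d. \<phi> x)"
    proof (rule sum.cong[OF refl])
      fix l show "\<phi> ((\<pi> ^^ l) x) = \<phi> x"
        by (induction l) (simp_all add: psubset.prems(3) in_\<Omega>[OF x(1)])
    qed
    also have "\<dots> = 0" using p_dvd p(2) by auto
    finally have sum_O': "sum \<phi> O' = 0" .
    \<comment> \<open>A fixed point on the orbit, followed for the remaining \<open>d - l\<close>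
      steps, would show that \<open>x\<close> itself is fixed.\<close>
    have no_fix: "\<pi> y \<noteq> y" if "y \<in> O'" for y
    proof
      assume "\<pi> y = y"
      from that obtain l where l: "l < d" "y = (\<pi> ^^ l) x" unfolding O'_def by auto
      have "(\<pi> ^^ (d - l)) (\<pi> y) = (\<pi> ^^ (d - l)) y" using \<open>\<pi> y = y\<close> by simp
      moreover have "(\<pi> ^^ (d - l)) (\<pi> y) = (\<pi> ^^ (d - l + (1 + l))) x"
        unfolding l(2) funpow_add by simp
      moreover have "(\<pi> ^^ (d - l)) y = (\<pi> ^^ (d - l + l)) x"
        unfolding l(2) funpow_add by simp
      ultimately have "\<pi> x = x" using l(1) d(2) by simp
      then show False using x by simp
    qed
    have "x \<in> O'" using O'_all[of 0] by simp
    then have "sum \<phi> (\<Omega> - O') = sum \<phi> {x \<in> \<Omega> - O'. \<pi> x = x}"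
      using x O'_\<Omega> psubset.prems closed by (intro psubset.IH) auto
    moreover have "{x \<in> \<Omega> - O'. \<pi> x = x} = {x \<in> \<Omega>. \<pi> x = x}" using no_fix by auto
    moreover have "sum \<phi> \<Omega> = sum \<phi> O' + sum \<phi> (\<Omega> - O')"
      using sum.subset_diff[OF O'_\<Omega> psubset.hyps(1), of \<phi>] by (simp add: add.commute)
    ultimately show ?thesis using sum_O' by simp
  qed
qed

text \<open>From i binom(p^a, i) = p^a binom(p^a - 1, i - 1): if p did not divide the binomial
  coefficient, p^a would divide the smaller number i.\<close>

lemma prime_dvd_choose_prime_power:
  assumes "Factorial_Ring.prime p" "0 < i" "i < p ^ a"
  shows "p dvd (p ^ a choose i)"
proof (rule ccontr)
  assume "\<not> p dvd (p ^ a choose i)"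
  then have "coprime (p ^ a) (p ^ a choose i)"
    using assms(1) by (simp add: prime_imp_coprime)
  moreover have "i * (p ^ a choose i) = p ^ a * (p ^ a - 1 choose (i - 1))"
    using assms(2) by (rule times_binomial_minus1_eq)
  then have "p ^ a dvd i * (p ^ a choose i)" by simp
  ultimately have "p ^ a dvd i" by (simp add: coprime_dvd_mult_left_iff)
  then show False using assms by (auto dest: dvd_imp_le)
qed

text \<open>A unipotent Jordan block acting on families indexed from 1, used both for coordinates of
  points and for the variables of a block. At positive indices the value at 0 is never read.\<close>

definition shift :: "(nat \<Rightarrow> 'a::comm_ring_1) \<Rightarrow> nat \<Rightarrow> 'a" where
  "shift g j = (if 1 < j then g j + g (j - 1) else g j)"

text \<open>Binomial expansion of (1 + N)^l with N the index-lowering map; the induction step is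
  Pascal's rule.\<close>

lemma shift_funpow:
  assumes "1 \<le> j"
  shows "(shift ^^ l) g j = (\<Sum>i<j. of_nat (l choose i) * g (j - i))"
  using assms
proof (induction l arbitrary: j)
  case 0
  have "(\<Sum>i<j. of_nat (0 choose i) * g (j - i)) = (\<Sum>i\<in>{0}. of_nat (0 choose i) * g (j - i))"
    using 0 by (intro sum.mono_neutral_right) (auto simp: binomial_eq_0)
  then show ?case by simp
next
  case (Suc l)
  obtain m where m: "j = Suc m" using Suc.prems by (cases j) auto
  have 1: "(shift ^^ Suc l) g j = (\<Sum>i<j. of_nat (l choose i) * g (j - i)) +
      (\<Sum>i<m. of_nat (l choose i) * g (m - i))"
    using Suc.IH[of j] Suc.IH[of m] unfolding m by (cases m) (simp_all add: shift_def[of "(shift ^^ l) g"])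
  show ?case unfolding 1 unfolding m sum.lessThan_Suc_shift
    by (simp add: sum.distrib algebra_simps)
qed

text \<open>Where p = 0, (1 + N)^{p^a} = 1 + N^{p^a}, and N^{p^a} kills a block of length at most
  p^a.\<close>

lemma shift_funpow_prime_power:
  fixes g :: "nat \<Rightarrow> 'a::comm_ring_1"
  assumes p: "Factorial_Ring.prime p" "of_nat p = (0::'a)" and j: "1 \<le> j" "j \<le> p ^ a"
  shows "(shift ^^ (p ^ a)) g j = g j"
proof -
  have "(shift ^^ (p ^ a)) g j = (\<Sum>i<j. of_nat (p ^ a choose i) * g (j - i))"
    by (rule shift_funpow) fact
  also have "\<dots> = (\<Sum>i\<in>{0}. of_nat (p ^ a choose i) * g (j - i))"
  proof (rule sum.mono_neutral_right)
    have "of_nat (p ^ a choose i) = (0::'a)" if "0 < i" "i < j" for i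
      using prime_dvd_choose_prime_power[OF p(1), of i a] that j p(2) by auto
    then show "\<forall>i\<in>{..<j} - {0}. of_nat (p ^ a choose i) * g (j - i) = 0" by auto
  qed (use j in auto)
  finally show ?thesis by simp
qed

section \<open>Homogeneous polynomials\<close>

definition mdeg :: "('x \<Rightarrow>\<^sub>0 nat) \<Rightarrow> nat" where
  "mdeg m = (\<Sum>x\<in>keys m. lookup m x)"

lemma mdeg_superset: "finite A \<Longrightarrow> keys m \<subseteq> A \<Longrightarrow> mdeg m = (\<Sum>x\<in>A. lookup m x)"
  unfolding mdeg_def by (rule sum.mono_neutral_left) (auto simp: in_keys_iff)

lemma mdeg_0 [simp]: "mdeg 0 = 0"
  by (simp add: mdeg_def)

lemma mdeg_single [simp]: "mdeg (single x d) = d"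
  by (simp add: mdeg_def)

lemma mdeg_add [simp]: "mdeg (m + m') = mdeg m + mdeg m'"
proof -
  let ?A = "keys m \<union> keys m'"
  have "keys (m + m') \<subseteq> ?A" by (rule keys_add)
  then show ?thesis by (simp add: mdeg_superset[of ?A] lookup_add sum.distrib)
qed

lemma mdeg_eq_0_iff [simp]: "mdeg m = 0 \<longleftrightarrow> m = 0"
proof
  assume "mdeg m = 0"
  then show "m = 0" by (intro poly_mapping_eqI) (auto simp: mdeg_def in_keys_iff)
qed simp

lemma homogeneous_iff: "homogeneous d f \<longleftrightarrow> (\<forall>m\<in>keys f. mdeg m = d)"
  by (simp add: homogeneous_def mdeg_def)

lemma homogeneous_add: "homogeneous d f \<Longrightarrow> homogeneous d g \<Longrightarrow> homogeneous d (f + g)"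
  using keys_add[of f g] by (auto simp: homogeneous_iff)

lemma homogeneous_mult:
  "homogeneous d f \<Longrightarrow> homogeneous d' g \<Longrightarrow> homogeneous (d + d') (f * g)"
  using keys_mult[of f g] by (force simp: homogeneous_iff)

lemma homogeneous_1: "homogeneous 0 1"
  by (simp add: homogeneous_iff)

lemma homogeneous_power: "homogeneous d f \<Longrightarrow> homogeneous (l * d) (f ^ l)"
  by (induction l) (simp_all add: homogeneous_1 homogeneous_mult)

lemma homogeneous_0: "homogeneous d 0"
  by (simp add: homogeneous_iff)

lemma homogeneous_sum: "(\<And>i. i \<in> A \<Longrightarrow> homogeneous d (g i)) \<Longrightarrow> homogeneous d (sum g A)"
  by (induction A rule: infinite_finite_induct) (simp_all add: homogeneous_0 homogeneous_add)

lemma homogeneous_prod: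
  "(\<And>i. i \<in> A \<Longrightarrow> homogeneous 1 (g i)) \<Longrightarrow> homogeneous (card A) (prod g A)"
proof (induction A rule: infinite_finite_induct)
  case (insert i A)
  then show ?case using homogeneous_mult[of 1 "g i" "card A" "prod g A"] by simp
qed (simp_all add: homogeneous_1)

lemma homogeneous_Var: "homogeneous 1 (Var x :: ('x, 'k::comm_ring_1) mpoly)"
  by (simp add: homogeneous_iff Var_def)

lemma homogeneous_Const_times: "homogeneous d f \<Longrightarrow> homogeneous d (Const c * f)"
  by (auto simp: homogeneous_iff in_keys_iff lookup_Const_times)

section \<open>Power sums over the prime field\<close>

lemma of_nat_power_CHAR:
  assumes "Factorial_Ring.prime CHAR('k::comm_semiring_1)"
  shows "(of_nat l :: 'k) ^ CHAR('k) = of_nat l"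
proof (induction l)
  case 0
  then show ?case using prime_gt_0_nat[OF assms] by (simp add: zero_power)
next
  case (Suc l)
  then show ?case using freshmans_dream[OF assms refl, of 1 "of_nat l"] by simp
qed

lemma of_nat_power_CHAR_minus_1:
  fixes l :: nat
  assumes "Factorial_Ring.prime CHAR('k::field)" "(of_nat l :: 'k) \<noteq> 0"
  shows "(of_nat l :: 'k) ^ (CHAR('k) - 1) = 1"
proof -
  have "(of_nat l :: 'k) * of_nat l ^ (CHAR('k) - 1) = of_nat l"
    using of_nat_power_CHAR[OF assms(1), of l] prime_gt_0_nat[OF assms(1)]
    by (metis Suc_diff_1 power_Suc)
  then show ?thesis using assms(2) by simp
qed

text \<open>Telescoping \<open>(l + 1)\<^bsup>d+1\<^esup> - l\<^bsup>d+1\<^esup>\<close> over \<open>l < p\<close> expresses \<open>d + 1\<close> times the \<open>d\<close>-th power sum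
  through the lower ones.\<close>

lemma power_sum_eq_0:
  assumes p: "Factorial_Ring.prime CHAR('k::field)" and "d < CHAR('k) - 1"
  shows "(\<Sum>l<CHAR('k). (of_nat l :: 'k) ^ d) = 0"
  using assms(2)
proof (induction d rule: less_induct)
  case (less d)
  let ?p = "CHAR('k)"
  have "(0::'k) = (\<Sum>l<?p. of_nat (Suc l) ^ Suc d - of_nat l ^ Suc d)"
    using sum_lessThan_telescope[of "\<lambda>l. (of_nat l :: 'k) ^ Suc d" ?p] by simp
  also have "\<dots> = (\<Sum>l<?p. \<Sum>i\<le>d. of_nat (Suc d choose i) * of_nat l ^ i)"
  proof (rule sum.cong[OF refl])
    fix l
    have "(of_nat (Suc l) :: 'k) ^ Suc d = (of_nat l + 1) ^ Suc d" by (simp add: add.commute)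
    also have "\<dots> = (\<Sum>i\<le>Suc d. of_nat (Suc d choose i) * of_nat l ^ i)"
      by (simp only: binomial_ring power_one mult_1_right)
    finally show "(of_nat (Suc l) :: 'k) ^ Suc d - of_nat l ^ Suc d =
        (\<Sum>i\<le>d. of_nat (Suc d choose i) * of_nat l ^ i)"
      by (simp only: sum.atMost_Suc binomial_n_n of_nat_1 mult_1_left add_diff_cancel_right')
  qed
  also have "\<dots> = (\<Sum>i\<le>d. of_nat (Suc d choose i) * (\<Sum>l<?p. (of_nat l :: 'k) ^ i))"
    unfolding sum_distrib_left by (rule sum.swap)
  also have "\<dots> = (\<Sum>i\<in>{d}. of_nat (Suc d choose i) * (\<Sum>l<?p. (of_nat l :: 'k) ^ i))"
    using less by (intro sum.mono_neutral_right) auto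
  finally have "of_nat (Suc d) * (\<Sum>l<?p. (of_nat l :: 'k) ^ d) = 0" by simp
  \<comment> \<open>The bound on \<open>d\<close> makes \<open>d + 1\<close> a nonzero residue, so
    it can be cancelled.\<close>
  moreover have "(of_nat (Suc d) :: 'k) \<noteq> 0"
    using less.prems by (simp only: of_nat_eq_0_iff_char_dvd) (auto dest: dvd_imp_le)
  ultimately show ?case by (simp only: mult_eq_0_iff) simp
qed

section \<open>Powers of a terminal variable\<close>

text \<open>The substitution computed in \<open>dual_act_jordan\<close>, detached from the group and
  total on all index pairs, so that the ideal theory works with an explicit map.\<close>

definition jordan_var :: "nat \<times> nat \<Rightarrow> (nat \<times> nat, 'k::comm_ring_1) mpoly" where
  "jordan_var x = (if 1 < fst x then Var x + Var (fst x - 1, snd x) else Var x)"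

abbreviation jordan_map :: "(nat \<times> nat, 'k::comm_ring_1) mpoly \<Rightarrow> (nat \<times> nat, 'k) mpoly" where
  "jordan_map \<equiv> peval Const jordan_var"

definition block_point :: "nat \<Rightarrow> (nat \<Rightarrow> 'k::comm_ring_1) \<Rightarrow> nat \<times> nat \<Rightarrow> 'k" where
  "block_point i u x = (if snd x = i then u (fst x) else 0)"

text \<open>Both sides are homomorphisms, so variables suffice. This moves the action from
  polynomials to points of one block, where orbits can be counted.\<close>

lemma peval_jordan_map:
  "peval (\<lambda>c. c) (block_point i u) (jordan_map f) = peval (\<lambda>c. c) (block_point i (shift u)) f"
  for f :: "(nat \<times> nat, 'k::comm_ring_1) mpoly"
proof (rule ring_map_ext[where I = UNIV])
  have r: "ring_map (peval (\<lambda>c::'k. c) s)" for s :: "nat \<times> nat \<Rightarrow> 'k"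
    by (intro ring_map.ring_map_peval ring_map_ident)
  show "ring_map (\<lambda>f. peval (\<lambda>c::'k. c) (block_point i u) (jordan_map f))"
    by (rule ring_map_comp[OF r ring_map.ring_map_peval[OF ring_map_Const]])
  show "ring_map (peval (\<lambda>c::'k. c) (block_point i (shift u)))" by (rule r)
  fix x :: "nat \<times> nat"
  show "peval (\<lambda>c::'k. c) (block_point i u) (jordan_map (Var x)) =
      peval (\<lambda>c. c) (block_point i (shift u)) (Var x)"
    by (simp add: ring_map.peval_Var[OF ring_map_Const] ring_map.peval_Var[OF ring_map_ident]
      jordan_var_def ring_map.peval_add[OF ring_map_ident] block_point_def shift_def)
qed (simp_all add: ring_map.peval_Const[OF ring_map_Const] ring_map.peval_Const[OF ring_map_ident]
      mem_polys_iff)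

lemma eq_single_if_keys_subset:
  assumes "keys m \<subseteq> {x}" shows "m = single x (lookup m x)"
proof (rule poly_mapping_eqI)
  fix y
  show "lookup m y = lookup (single x (lookup m x)) y"
  proof (cases "y = x")
    case False
    then have "y \<notin> keys m" using assms by blast
    then show ?thesis using False by (simp add: lookup_single when_def in_keys_iff)
  qed simp
qed

lemma shift_cong: "g j = h j \<Longrightarrow> (1 < j \<Longrightarrow> g (j - 1) = h (j - 1)) \<Longrightarrow> shift g j = shift h j"
  by (simp add: shift_def)

lemma inj_on_of_nat_CHAR: "inj_on (of_nat :: nat \<Rightarrow> 'a::ring_1) {..<CHAR('a)}"
proof (rule linorder_inj_onI)
  fix l l' assume l: "l < l'" "l' \<in> {..<CHAR('a)}"
  show "of_nat l \<noteq> (of_nat l' :: 'a)"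
  proof
    assume "of_nat l = (of_nat l' :: 'a)"
    then have "of_nat (l' - l) = (0::'a)" using l by simp
    then have "CHAR('a) dvd l' - l" by (simp only: of_nat_eq_0_iff_char_dvd)
    then show False using l by (auto dest: dvd_imp_le)
  qed
qed auto

text \<open>A variable of another block makes every term 0. Otherwise the sum over the grid factors
  into one-variable power sums, and the degree bound forces one exponent below p - 1, where the
  power sum vanishes.\<close>

lemma sum_block_point_monom_eval:
  fixes m :: "nat \<times> nat \<Rightarrow>\<^sub>0 nat"
  assumes p: "Factorial_Ring.prime CHAR('k::field)"
    and m: "keys m \<subseteq> jordan_index k n" "mdeg m < n i * (CHAR('k) - 1)"
  shows "(\<Sum>u\<in>PiE {1..n i} (\<lambda>_. of_nat ` {..<CHAR('k)}).
      monom_eval (block_point i u) m) = (0::'k)"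
proof (cases "\<exists>x\<in>keys m. snd x \<noteq> i")
  case True
  then obtain x where x: "x \<in> keys m" "snd x \<noteq> i" by auto
  have "monom_eval (block_point i u) m = 0" for u :: "nat \<Rightarrow> 'k"
    unfolding monom_eval_def using x
    by (intro prod_zero bexI[of _ x]) (auto simp: block_point_def in_keys_iff)
  then show ?thesis by simp
next
  case False
  let ?F = "of_nat ` {..<CHAR('k)} :: 'k set" and ?B = "(\<lambda>j. (j, i)) ` {1..n i}"
  have B: "keys m \<subseteq> ?B" using m(1) False by (force simp: jordan_index_def)
  have inj: "inj_on (\<lambda>j. (j, i)) A" for A :: "nat set" by (auto simp: inj_on_def)
  have "(\<Sum>j\<in>{1..n i}. lookup m (j, i)) < (\<Sum>j\<in>{1..n i}. CHAR('k) - 1)"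
    using m(2) mdeg_superset[OF _ B] by (simp add: sum.reindex[OF inj])
  then obtain j where j: "j \<in> {1..n i}" "lookup m (j, i) < CHAR('k) - 1"
    by (meson not_less sum_mono)
  have j0: "(\<Sum>t\<in>?F. t ^ lookup m (j, i)) = 0"
    using power_sum_eq_0[OF p j(2)] by (simp add: sum.reindex[OF inj_on_of_nat_CHAR])
  have "(\<Sum>u\<in>PiE {1..n i} (\<lambda>_. ?F). monom_eval (block_point i u) m) =
      (\<Sum>u\<in>PiE {1..n i} (\<lambda>_. ?F). \<Prod>j\<in>{1..n i}. u j ^ lookup m (j, i))"
    by (intro sum.cong refl)
      (simp add: monom_eval_superset[OF _ B] prod.reindex[OF inj] block_point_def)
  also have "\<dots> = (\<Prod>j\<in>{1..n i}. \<Sum>t\<in>?F. t ^ lookup m (j, i))"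
    by (rule prod_sum_PiE[symmetric]) auto
  also have "\<dots> = 0"
    by (rule prod_zero) (use j j0 in auto)
  finally show ?thesis .
qed

text \<open>Chevalley--Warning for cyclic groups: for \<open>d < n i\<close> the sum of \<open>f\<^bsup>p-1\<^esup>\<close> over the points of the
  block with coordinates in the prime field vanishes by degree reasons. The points fall into orbits
  of \<open>p\<close>-power length, so the sum is also the one over the fixed points, which form the line dual to
  the terminal variable.\<close>

lemma invariant_lookup_terminal_power_small:
  fixes f :: "(nat \<times> nat, 'k::field) mpoly"
  assumes p: "Factorial_Ring.prime CHAR('k)"
    and n: "n i \<le> CHAR('k) ^ r"
    and f: "f \<in> polys (jordan_index k n)" "jordan_map f = f" "homogeneous d f"
    and d: "0 < d" "d < n i"
  shows "lookup f (single (n i, i) d) = 0"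
proof (rule ccontr)
  let ?p = "CHAR('k)" and ?c = "lookup f (single (n i, i) d)"
  let ?F = "of_nat ` {..<CHAR('k)} :: 'k set" and ?I = "{1..n i}"
  assume c: "?c \<noteq> 0"
  note id = ring_map.peval_add[OF ring_map_ident] ring_map.peval_mult[OF ring_map_ident]
  have p0: "of_nat ?p = (0::'k)" by simp
  have p2: "2 \<le> ?p" using p by (rule prime_ge_2_nat)
  define ev where "ev u f = peval (\<lambda>c::'k. c) (block_point i u) f" for u f
  \<comment> \<open>Restriction to the indices of the block makes points extensional functions:
    \<open>\<Omega>\<close> is then finite, and equality of points means equality of
    coordinates.\<close>
  define \<pi> where "\<pi> u = restrict (shift u) ?I" for u :: "nat \<Rightarrow> 'k"
  define \<Omega> where "\<Omega> = PiE ?I (\<lambda>_. ?F)"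
  have ev_pow: "ev u (g ^ l) = ev u g ^ l" for u g l
    unfolding ev_def by (rule ring_map.power, intro ring_map.ring_map_peval ring_map_ident)
  have add_F: "s + t \<in> ?F" if "s \<in> ?F" "t \<in> ?F" for s t
  proof -
    obtain a b where "s = of_nat a" "t = of_nat b" using \<open>s \<in> ?F\<close> \<open>t \<in> ?F\<close> by auto
    then have st: "s + t = of_nat (a + b)" by simp
    have "of_nat (a + b) = (of_nat ((a + b) mod ?p + (a + b) div ?p * ?p) :: 'k)" by simp
    also have "\<dots> = of_nat ((a + b) mod ?p)" by (simp only: of_nat_add of_nat_mult p0) simp
    finally show ?thesis unfolding st using p2 by (intro image_eqI[where x = "(a + b) mod ?p"]) auto
  qed
  have \<pi>_\<Omega>: "\<pi> u \<in> \<Omega>" if u: "u \<in> \<Omega>" for u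
  proof -
    have uF: "u j \<in> ?F" if "j \<in> ?I" for j
      using u that unfolding \<Omega>_def by (rule PiE_mem)
    have "shift u j \<in> ?F" if "j \<in> ?I" for j
    proof (cases "1 < j")
      case True
      then have "j - 1 \<in> ?I" using that by auto
      then show ?thesis using True add_F[OF uF[OF that] uF] by (simp add: shift_def)
    qed (use uF[OF that] in \<open>simp add: shift_def\<close>)
    then show ?thesis unfolding \<pi>_def \<Omega>_def by (auto simp: restrict_def PiE_def extensional_def Pi_def)
  qed
  have \<pi>_pow: "(\<pi> ^^ l) u j = (shift ^^ l) u j" if "j \<in> ?I" for l u j
    using that
  proof (induction l arbitrary: j)
    case (Suc l)
    have "shift ((\<pi> ^^ l) u) j = shift ((shift ^^ l) u) j"
      by (intro shift_cong Suc.IH) (use Suc.prems in auto)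
    then show ?case using Suc.prems by (simp add: \<pi>_def[of "(\<pi> ^^ l) u"])
  qed simp
  have ev_f: "ev (\<pi> u) f = ev u f" for u
  proof -
    have "ev (\<pi> u) f = ev (shift u) f"
      unfolding ev_def
    proof (rule peval_cong)
      fix m x assume "m \<in> keys f" "x \<in> keys m"
      then have "x \<in> jordan_index k n" using f(1) by (auto simp: mem_polys_iff)
      then show "block_point i (\<pi> u) x = block_point i (shift u) x"
        by (auto simp: jordan_index_def block_point_def \<pi>_def)
    qed
    then show ?thesis using peval_jordan_map[of i u f] f(2) by (simp add: ev_def)
  qed
  \<comment> \<open>The exponent p - 1 serves twice: the degree d(p - 1) stays below n_i(p - 1), and
    nonzero elements of the prime field become 1.\<close>
  define \<phi> where "\<phi> u = ev u f ^ (?p - 1)" for u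
  have "sum \<phi> \<Omega> = 0"
  proof -
    define g where "g = f ^ (?p - 1)"
    have g: "keys m \<subseteq> jordan_index k n" "mdeg m < n i * (?p - 1)" if "m \<in> keys g" for m
    proof -
      show "keys m \<subseteq> jordan_index k n"
        using polys_power[OF f(1)] that unfolding g_def by (auto simp: mem_polys_iff)
      have "mdeg m = (?p - 1) * d"
        using homogeneous_power[OF f(3)] that unfolding g_def homogeneous_iff by auto
      then show "mdeg m < n i * (?p - 1)" using d p2 by (simp add: mult.commute)
    qed
    have "sum \<phi> \<Omega> = (\<Sum>u\<in>\<Omega>. \<Sum>m\<in>keys g. lookup g m * monom_eval (block_point i u) m)"
      unfolding \<phi>_def ev_pow[symmetric] g_def[symmetric] unfolding ev_def peval_def ..
    also have "\<dots> = (\<Sum>m\<in>keys g. lookup g m * (\<Sum>u\<in>\<Omega>. monom_eval (block_point i u) m))"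
      unfolding sum_distrib_left by (rule sum.swap)
    also have "\<dots> = 0"
      unfolding \<Omega>_def using sum_block_point_monom_eval[OF p g] by (intro sum.neutral ballI) simp
    finally show ?thesis .
  qed
  moreover have "sum \<phi> \<Omega> = sum \<phi> {u \<in> \<Omega>. \<pi> u = u}"
  proof (rule sum_eq_sum_fixed_points[OF p p0])
    show "finite \<Omega>" unfolding \<Omega>_def by (intro finite_PiE) auto
    fix u assume u: "u \<in> \<Omega>"
    show "\<pi> u \<in> \<Omega>" by (rule \<pi>_\<Omega>) fact
    show "\<phi> (\<pi> u) = \<phi> u" by (simp add: \<phi>_def ev_f)
    have "(\<pi> ^^ l) u \<in> \<Omega>" for l by (induction l) (auto simp: \<pi>_\<Omega> u)
    then show "(\<pi> ^^ (?p ^ r)) u = u"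
    proof (intro PiE_ext[where k = ?I and s = "\<lambda>_. ?F"])
      fix j assume "j \<in> ?I"
      then show "(\<pi> ^^ (?p ^ r)) u j = u j"
        using shift_funpow_prime_power[OF p p0, of j r u] n \<pi>_pow by simp
    qed (use u \<Omega>_def in auto)
  qed
  moreover have "sum \<phi> {u \<in> \<Omega>. \<pi> u = u} = - (?c ^ (?p - 1))"
  proof -
    define line where "line t = (\<lambda>j\<in>?I. if j = n i then t else 0)" for t :: 'k
    have ni: "n i \<in> ?I" using d by auto
    \<comment> \<open>Coordinate \<open>j + 1\<close> of the equation \<open>\<pi> u = u\<close>
      gives \<open>u j = 0\<close> for every \<open>j < n i\<close>; only the terminal coordinate is
      free.\<close>
    have fixed: "{u \<in> \<Omega>. \<pi> u = u} = line ` ?F"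
    proof safe
      fix u assume u: "u \<in> \<Omega>" "\<pi> u = u"
      have "u j = 0" if "j \<in> ?I" "j \<noteq> n i" for j
      proof -
        have "\<pi> u (j + 1) = u (j + 1)" by (simp add: u(2))
        then show ?thesis using that by (auto simp: \<pi>_def shift_def)
      qed
      then have "u = line (u (n i))"
        using u(1) unfolding line_def \<Omega>_def by (auto simp: fun_eq_iff PiE_def extensional_def)
      moreover have "u (n i) \<in> ?F" using u(1) ni unfolding \<Omega>_def by auto
      ultimately show "u \<in> line ` ?F" by blast
    next
      fix l assume l: "l < ?p"
      have "(0::'k) \<in> ?F" using p2 by (intro image_eqI[of _ _ 0]) auto
      then show "line (of_nat l) \<in> \<Omega>" using l unfolding line_def \<Omega>_def by auto
      show "\<pi> (line (of_nat l)) = line (of_nat l)"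
        unfolding \<pi>_def shift_def line_def by (auto simp: fun_eq_iff restrict_def)
    qed
    have inj: "inj_on line A" for A
      using ni by (intro inj_onI) (auto simp: line_def fun_eq_iff restrict_def split: if_splits)
    \<comment> \<open>On this line only powers of the terminal variable survive, and homogeneity
      leaves the one of degree \<open>d\<close>.\<close>
    have ev_line: "ev (line t) f = ?c * t ^ d" for t
    proof -
      have "ev (line t) f = (\<Sum>m\<in>keys f. lookup f m * monom_eval (block_point i (line t)) m)"
        by (simp add: ev_def peval_def)
      also have "\<dots> = (\<Sum>m\<in>{single (n i, i) d}. lookup f m * monom_eval (block_point i (line t)) m)"
      proof (rule sum.mono_neutral_right)
        show "\<forall>m\<in>keys f - {single (n i, i) d}. lookup f m * monom_eval (block_point i (line t)) m = 0"
        proof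
          fix m assume m: "m \<in> keys f - {single (n i, i) d}"
          have "\<exists>x\<in>keys m. x \<noteq> (n i, i)"
          proof (rule ccontr)
            assume "\<not> ?thesis"
            then have sub: "keys m \<subseteq> {(n i, i)}" by auto
            moreover have "mdeg m = d" using m f(3) by (simp add: homogeneous_iff)
            ultimately have "lookup m (n i, i) = d" using mdeg_superset[of "{(n i, i)}" m] by simp
            then have "m = single (n i, i) d" using eq_single_if_keys_subset[OF sub] by simp
            then show False using m by simp
          qed
          then obtain x where x: "x \<in> keys m" "x \<noteq> (n i, i)" by auto
          then have "x \<in> jordan_index k n" using m f(1) by (auto simp: mem_polys_iff)
          then have "block_point i (line t) x = 0"
            using x(2) by (auto simp: block_point_def line_def jordan_index_def)
          then have "monom_eval (block_point i (line t)) m = 0"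
            unfolding monom_eval_def using x(1) by (intro prod_zero bexI[of _ x]) (auto simp: in_keys_iff)
          then show "lookup f m * monom_eval (block_point i (line t)) m = 0" by simp
        qed
      qed (use c in \<open>auto simp: in_keys_iff\<close>)
      also have "\<dots> = ?c * t ^ d" using ni by (simp add: block_point_def line_def)
      finally show ?thesis .
    qed
    have "sum \<phi> {u \<in> \<Omega>. \<pi> u = u} = (\<Sum>l<?p. (?c * of_nat l ^ d) ^ (?p - 1))"
      unfolding fixed by (simp add: sum.reindex[OF inj] sum.reindex[OF inj_on_of_nat_CHAR] \<phi>_def ev_line)
    also have "\<dots> = (\<Sum>l<?p. if l = 0 then 0 else ?c ^ (?p - 1))"
    proof (rule sum.cong[OF refl])
      fix l assume l: "l \<in> {..<?p}"
      show "(?c * of_nat l ^ d) ^ (?p - 1) = (if l = 0 then 0 else ?c ^ (?p - 1))"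
      proof (cases "l = 0")
        case True
        then show ?thesis using d p2 by simp
      next
        case False
        then have "(of_nat l :: 'k) \<noteq> 0"
          using l by (auto simp only: of_nat_eq_0_iff_char_dvd dest: dvd_imp_le)
        then have "(of_nat l :: 'k) ^ (?p - 1) = 1" by (rule of_nat_power_CHAR_minus_1[OF p])
        then have "((of_nat l :: 'k) ^ d) ^ (?p - 1) = 1"
          by (metis power_mult mult.commute power_one)
        then show ?thesis using False by (simp add: power_mult_distrib)
      qed
    qed
    \<comment> \<open>Each of the p - 1 nonzero parameters contributes the same value, and p - 1 is
      -1 in the field.\<close>
    also have "\<dots> = of_nat (?p - 1) * ?c ^ (?p - 1)"
    proof -
      have "{..<?p} = insert 0 {1..<?p}" using p2 by auto
      then show ?thesis by simp
    qed
    also have "of_nat (?p - 1) = (- 1 :: 'k)"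
      using p2 by simp
    finally show ?thesis by simp
  qed
  ultimately show False using c by simp
qed

section \<open>Taylor expansion\<close>

lemma keys_add_nat: "keys (m + m' :: 'x \<Rightarrow>\<^sub>0 nat) = keys m \<union> keys m'"
  by (auto simp: in_keys_iff lookup_add)

lemma eq_single_add_diff: "0 < lookup m x \<Longrightarrow> m = single x 1 + (m - single x 1)"
  for m :: "'x \<Rightarrow>\<^sub>0 nat"
  by (intro poly_mapping_eqI) (auto simp: lookup_add lookup_minus lookup_single when_def)

lemma peval_0 [simp]: "peval h s 0 = 0"
  by (simp add: peval_def)

lemma ring_map_Const_Const: "ring_map (\<lambda>c. Const (Const c))"
  by (rule ring_map_comp[OF ring_map_Const ring_map_Const])

text \<open>Two levels: the outer variables are the increments t, the coefficients stay polynomials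
  in x. The coefficient at \<beta> is the divided (Hasse) derivative of order \<beta>, which makes
  sense in any characteristic.\<close>

definition taylor :: "'x set \<Rightarrow> ('x, 'k::comm_ring_1) mpoly \<Rightarrow> ('x, ('x, 'k) mpoly) mpoly" where
  "taylor Z = peval (\<lambda>c. Const (Const c)) (\<lambda>x. Const (Var x) + (if x \<in> Z then Var x else 0))"

lemma ring_map_taylor: "ring_map (taylor Z)"
  unfolding taylor_def by (rule ring_map.ring_map_peval[OF ring_map_Const_Const])

lemma taylor_Const: "taylor Z (Const c) = Const (Const c)"
  unfolding taylor_def by (rule ring_map.peval_Const[OF ring_map_Const_Const])

lemma taylor_Var: "taylor Z (Var x) = Const (Var x) + (if x \<in> Z then Var x else 0)"
  unfolding taylor_def by (rule ring_map.peval_Var[OF ring_map_Const_Const])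

text \<open>The numerical factor of x^m t^\<beta> in (x + t)^(m + \<beta>), indexed by m and \<beta>
  so that no subtraction of exponents occurs.\<close>

definition choose_prod :: "'x set \<Rightarrow> ('x \<Rightarrow>\<^sub>0 nat) \<Rightarrow> ('x \<Rightarrow>\<^sub>0 nat) \<Rightarrow> nat" where
  "choose_prod Z m \<beta> = (\<Prod>y\<in>Z. (lookup m y + lookup \<beta> y) choose lookup \<beta> y)"

lemma choose_prod_remove:
  assumes "finite Z" "x \<in> Z"
  shows "choose_prod Z m \<beta> = ((lookup m x + lookup \<beta> x) choose lookup \<beta> x) * choose_prod (Z - {x}) m \<beta>"
  unfolding choose_prod_def by (rule prod.remove) fact+

lemma choose_prod_cong:
  "(\<And>y. y \<in> Z \<Longrightarrow> lookup m y = lookup m' y) \<Longrightarrow> (\<And>y. y \<in> Z \<Longrightarrow> lookup \<beta> y = lookup \<beta>' y) \<Longrightarrow>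
    choose_prod Z m \<beta> = choose_prod Z m' \<beta>'"
  unfolding choose_prod_def by (rule prod.cong) simp_all

text \<open>The two summands are what x and t_x contribute when a monomial is multiplied by x + t_x.
  The guards protect the truncated subtractions; outside \<open>Z\<close> there is no t_x.\<close>

lemma choose_prod_Pascal:
  assumes "finite Z" "keys \<beta> \<subseteq> Z" "0 < lookup m x + lookup \<beta> x"
  shows "choose_prod Z m \<beta> = (if 0 < lookup m x then choose_prod Z (m - single x 1) \<beta> else 0) +
    (if x \<in> Z \<and> 0 < lookup \<beta> x then choose_prod Z m (\<beta> - single x 1) else 0)"
proof (cases "x \<in> Z")
  case False
  then have "lookup \<beta> x = 0" using assms(2) by (auto simp: in_keys_iff)
  moreover have "choose_prod Z m \<beta> = choose_prod Z (m - single x 1) \<beta>"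
    using False by (intro choose_prod_cong) (auto simp: lookup_minus lookup_single when_def)
  ultimately show ?thesis using assms(3) False by simp
next
  case True
  let ?Y = "Z - {x}"
  have Y: "choose_prod ?Y (m - single x 1) \<beta> = choose_prod ?Y m \<beta>"
    "choose_prod ?Y m (\<beta> - single x 1) = choose_prod ?Y m \<beta>"
    by (rule choose_prod_cong; auto simp: lookup_minus lookup_single when_def)+
  obtain u v where uv: "lookup m x = u" "lookup \<beta> x = v" by auto
  have "(u + v) choose v = (if 0 < u then (u - 1 + v) choose v else 0) +
      (if 0 < v then (u + (v - 1)) choose (v - 1) else 0)"
    using assms(3) uv by (cases u; cases v) simp_all
  then show ?thesis
    unfolding choose_prod_remove[OF assms(1) True] Y using True uv
    by (simp add: lookup_minus lookup_single add_mult_distrib)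
qed

lemma single_induct [case_names zero add_single]:
  fixes m :: "'x \<Rightarrow>\<^sub>0 nat"
  assumes "P 0" "\<And>m x. P m \<Longrightarrow> P (single x 1 + m)"
  shows "P m"
proof (induction "mdeg m" arbitrary: m)
  case 0
  then show ?case using assms(1) by simp
next
  case (Suc d)
  then have "m \<noteq> 0" by auto
  then obtain x where "lookup m x \<noteq> 0" by (metis lookup_zero poly_mapping_eqI)
  then have m: "m = single x 1 + (m - single x 1)" by (intro eq_single_add_diff) simp
  then have "mdeg m = 1 + mdeg (m - single x 1)" by (metis mdeg_add mdeg_single)
  then have "P (m - single x 1)" using Suc by auto
  then show ?case using assms(2) m by metis
qed

text \<open>Monomials are built up one variable at a time, each step being Pascal's rule; linearity
  does the rest. The binomial factors decide later what survives modulo p.\<close>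

lemma lookup_lookup_taylor:
  assumes Z: "finite Z"
  shows "lookup (lookup (taylor Z f) \<beta>) m =
    (if keys \<beta> \<subseteq> Z then of_nat (choose_prod Z m \<beta>) * lookup f (m + \<beta>) else 0)"
    (is "_ = ?rhs f \<beta> m")
proof -
  interpret \<tau>: ring_map "taylor Z" by (rule ring_map_taylor)
  have single: "\<forall>\<beta> m. lookup (lookup (taylor Z (single m' c)) \<beta>) m = ?rhs (single m' c) \<beta> m" for m' c
  proof (induction m' rule: single_induct)
    case zero
    have "m = 0" if "m + \<beta> = 0" for m \<beta> :: "'a \<Rightarrow>\<^sub>0 nat"
    proof (rule poly_mapping_eqI)
      fix x show "lookup m x = lookup 0 x"
        using arg_cong[OF that, of "\<lambda>m. lookup m x"] by (simp add: lookup_add)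
    qed
    then have "m + \<beta> = 0 \<longleftrightarrow> m = 0 \<and> \<beta> = 0" for m \<beta> :: "'a \<Rightarrow>\<^sub>0 nat"
      by (metis add.commute add_0)
    then show ?case
      by (auto simp: taylor_Const[unfolded Const_def] lookup_single when_def choose_prod_def)
  next
    case (add_single m' x)
    let ?f = "single m' c" and ?x = "single x 1 :: 'a \<Rightarrow>\<^sub>0 nat"
    have f: "single (?x + m') c = Var x * ?f" by (simp add: Var_def mult_single)
    show ?case
    proof (intro allI)
      fix \<beta> m
      have L: "lookup (lookup (taylor Z (Var x * ?f)) \<beta>) m =
          (if 0 < lookup m x then ?rhs ?f \<beta> (m - ?x) else 0) +
          (if x \<in> Z \<and> 0 < lookup \<beta> x then ?rhs ?f (\<beta> - ?x) m else 0)"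
        using add_single
        by (simp add: taylor_Var distrib_right lookup_add lookup_Const_times lookup_Var_times)
      have shift_m: "m - ?x + \<beta> = m + \<beta> - ?x" if "0 < lookup m x"
        using that by (intro poly_mapping_eqI) (auto simp: lookup_add lookup_minus lookup_single when_def)
      have shift_\<beta>: "m + (\<beta> - ?x) = m + \<beta> - ?x" if "0 < lookup \<beta> x"
        using that by (intro poly_mapping_eqI) (auto simp: lookup_add lookup_minus lookup_single when_def)
      have keys_\<beta>: "keys (\<beta> - ?x) \<subseteq> Z \<longleftrightarrow> keys \<beta> \<subseteq> Z" if "x \<in> Z"
      proof -
        have "keys (\<beta> - ?x) \<subseteq> keys \<beta>" by (auto simp: in_keys_iff lookup_minus)
        moreover have "keys \<beta> \<subseteq> insert x (keys (\<beta> - ?x))"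
          by (auto simp: in_keys_iff lookup_minus lookup_single when_def split: if_splits)
        ultimately show ?thesis using that by blast
      qed
      show "lookup (lookup (taylor Z (single (?x + m') c)) \<beta>) m = ?rhs (single (?x + m') c) \<beta> m"
      proof (cases "keys \<beta> \<subseteq> Z \<and> 0 < lookup m x + lookup \<beta> x")
        case True
        then show ?thesis
          unfolding f L choose_prod_Pascal[OF Z conjunct1[OF True] conjunct2[OF True]]
          using keys_\<beta> shift_m shift_\<beta>
          by (auto simp: lookup_Var_times lookup_add distrib_right)
      next
        case False
        then show ?thesis
          unfolding f L using keys_\<beta> by (auto simp: lookup_Var_times lookup_add)
      qed
    qed
  qed
  have "lookup (lookup (taylor Z f) \<beta>) m =
      (\<Sum>m'\<in>keys f. lookup (lookup (taylor Z (single m' (lookup f m'))) \<beta>) m)"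
    by (subst (1) poly_mapping_sum_single[of f]) (simp only: \<tau>.sum lookup_sum)
  also have "\<dots> = (\<Sum>m'\<in>keys f. ?rhs (single m' (lookup f m')) \<beta> m)"
    using single by simp
  also have "\<dots> = ?rhs (\<Sum>m'\<in>keys f. single m' (lookup f m')) \<beta> m"
    by (simp add: lookup_sum sum_distrib_left)
  finally show ?thesis by (simp flip: poly_mapping_sum_single)
qed

lemma keys_taylor: "finite Z \<Longrightarrow> \<beta> \<in> keys (taylor Z f) \<Longrightarrow> keys \<beta> \<subseteq> Z"
  using lookup_lookup_taylor[of Z f \<beta>] by (metis in_keys_iff lookup_zero poly_mapping_eqI)

lemma keys_lookup_taylor:
  "finite Z \<Longrightarrow> m \<in> keys (lookup (taylor Z f) \<beta>) \<Longrightarrow> m + \<beta> \<in> keys f"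
  by (auto simp: in_keys_iff lookup_lookup_taylor split: if_splits)

lemma lookup_taylor_polys:
  assumes "finite Z" "f \<in> polys I"
  shows "lookup (taylor Z f) \<beta> \<in> polys I"
  using keys_lookup_taylor[OF assms(1)] assms(2) unfolding mem_polys_iff
  by (fastforce simp: keys_add_nat)

lemma homogeneous_lookup_taylor:
  assumes "finite Z" "homogeneous d f"
  shows "homogeneous (d - mdeg \<beta>) (lookup (taylor Z f) \<beta>)"
  using keys_lookup_taylor[OF assms(1)] assms(2) unfolding homogeneous_iff
  by (metis add_diff_cancel_right' mdeg_add)

lemma lookup_taylor_eq_0:
  assumes "finite Z" "homogeneous d f" "d < mdeg \<beta>"
  shows "lookup (taylor Z f) \<beta> = 0"
proof (rule ccontr)
  assume "lookup (taylor Z f) \<beta> \<noteq> 0"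
  then obtain m where "m \<in> keys (lookup (taylor Z f) \<beta>)" by (metis all_not_in_conv keys_eq_empty)
  then have "m + \<beta> \<in> keys f" by (rule keys_lookup_taylor[OF assms(1)])
  then have "mdeg (m + \<beta>) = d" using assms(2) by (simp only: homogeneous_iff)
  then show False using assms(3) by simp
qed

lemma homogeneous_degree_0:
  assumes "homogeneous 0 f" shows "f = Const (lookup f 0)"
proof (rule poly_mapping_eqI)
  fix m
  show "lookup f m = lookup (Const (lookup f 0)) m"
    using assms by (auto simp: lookup_Const homogeneous_iff in_keys_iff)
qed

text \<open>In the top degree the coefficient is a constant, read off at exponent 0 where all
  binomial factors are 1. For an invariant these are the only nonzero Taylor coefficients that are
  not of positive degree.\<close>

lemma lookup_taylor_top_degree:
  assumes "finite Z" "homogeneous (mdeg \<beta>) f" "keys \<beta> \<subseteq> Z"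
  shows "lookup (taylor Z f) \<beta> = Const (lookup f \<beta>)"
proof -
  have "homogeneous 0 (lookup (taylor Z f) \<beta>)"
    using homogeneous_lookup_taylor[OF assms(1,2), of \<beta>] by simp
  then have "lookup (taylor Z f) \<beta> = Const (lookup (lookup (taylor Z f) \<beta>) 0)"
    by (rule homogeneous_degree_0)
  then show ?thesis
    using lookup_lookup_taylor[OF assms(1), of f \<beta> 0] assms(3) by (simp add: choose_prod_def)
qed

lemma taylor_eq_Const:
  assumes "f \<in> polys (- Z)" shows "taylor Z f = Const f"
  by (rule ring_map_ext[OF ring_map_taylor ring_map_Const _ _ assms])
    (simp_all add: taylor_Const taylor_Var)

lemma lookup_peval_Const_Var:
  assumes "ring_map h"
  shows "lookup (peval (\<lambda>c. Const (h c)) Var F) \<beta> = h (lookup F \<beta>)"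
proof -
  interpret ring_map h by fact
  have "lookup (peval (\<lambda>c. Const (h c)) Var F) \<beta> =
      (\<Sum>m\<in>keys F. if m = \<beta> then h (lookup F m) else 0)"
    by (simp add: peval_def monom_eval_Var lookup_sum lookup_Const_times lookup_single when_def
        if_distrib[of "(*) _"] cong: if_cong)
  also have "\<dots> = h (lookup F \<beta>)"
    by (auto simp: in_keys_iff)
  finally show ?thesis .
qed

text \<open>A substitution that changes every variable by a polynomial in the variables outside \<open>Z\<close>
  commutes with the translation \<open>x \<mapsto> x + t\<^sub>x\<close> of the variables in \<open>Z\<close>.\<close>

lemma lookup_taylor_subst:
  fixes s :: "'x \<Rightarrow> ('x, 'k::comm_ring_1) mpoly"
  assumes s: "\<And>x. x \<in> I \<Longrightarrow> s x - Var x \<in> polys (- Z)" and f: "f \<in> polys I"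
  shows "lookup (taylor Z (peval Const s f)) \<beta> = peval Const s (lookup (taylor Z f) \<beta>)"
proof -
  let ?s = "peval Const s" and ?S = "peval (\<lambda>c. Const (peval Const s c)) Var"
  interpret \<tau>: ring_map "taylor Z" by (rule ring_map_taylor)
  have s_map: "ring_map ?s" by (rule ring_map.ring_map_peval[OF ring_map_Const])
  interpret S: ring_map "\<lambda>c. Const (?s c)" by (rule ring_map_comp[OF ring_map_Const s_map])
  have "taylor Z (?s f) = ?S (taylor Z f)"
  proof (rule ring_map_ext[OF _ _ _ _ f])
    show "ring_map (\<lambda>f. taylor Z (?s f))" by (rule ring_map_comp[OF ring_map_taylor s_map])
    show "ring_map (\<lambda>f. ?S (taylor Z f))" by (rule ring_map_comp[OF S.ring_map_peval ring_map_taylor])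
    show "taylor Z (?s (Const c)) = ?S (taylor Z (Const c))" for c
      by (simp add: ring_map.peval_Const[OF ring_map_Const] taylor_Const S.peval_Const)
  next
    fix x assume x: "x \<in> I"
    have "taylor Z (s x) = taylor Z (Var x + (s x - Var x))"
      by simp
    also have "\<dots> = taylor Z (Var x) + taylor Z (s x - Var x)"
      by (rule \<tau>.add)
    also have "\<dots> = Const (s x) + (if x \<in> Z then Var x else 0)"
      unfolding taylor_eq_Const[OF s[OF x]] taylor_Var by (simp add: ring_map.diff[OF ring_map_Const])
    also have "\<dots> = ?S (taylor Z (Var x))"
      by (simp add: taylor_Var S.peval_add S.peval_Const S.peval_Var S.peval_sum
          ring_map.peval_Var[OF ring_map_Const] ring_map.zero[OF S.ring_map_peval])
    finally show "taylor Z (?s (Var x)) = ?S (taylor Z (Var x))"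
      by (simp add: ring_map.peval_Var[OF ring_map_Const])
  qed
  then show ?thesis by (simp add: lookup_peval_Const_Var[OF s_map])
qed

text \<open>Putting t = -x in f(x + t) kills the translated variables and leaves the others alone.
  If f is divisible by a translated variable the result is 0, which is how the norm is used.\<close>

lemma peval_uminus_taylor:
  "peval (\<lambda>c. c) (\<lambda>x. - Var x) (taylor Z f) = peval Const (\<lambda>x. if x \<in> Z then 0 else Var x) f"
  by (rule ring_map_ext[OF ring_map_comp[OF ring_map.ring_map_peval[OF ring_map_ident] ring_map_taylor]
        ring_map.ring_map_peval[OF ring_map_Const], where I = UNIV])
    (auto simp: taylor_Const taylor_Var mem_polys_iff ring_map.peval_Const[OF ring_map_Const]
      ring_map.peval_Var[OF ring_map_Const] ring_map.peval_add[OF ring_map_ident]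
      ring_map.peval_Const[OF ring_map_ident] ring_map.peval_Var[OF ring_map_ident])

lemma lookup_zero_out:
  fixes f :: "('x, 'k::comm_ring_1) mpoly"
  shows "lookup (peval Const (\<lambda>x. if x \<in> A then Var x else 0) f) m = (if keys m \<subseteq> A then lookup f m else 0)"
proof -
  let ?s = "\<lambda>x. if x \<in> A then Var x else (0 :: ('x, 'k) mpoly)"
  have "monom_eval ?s m' = (if keys m' \<subseteq> A then single m' 1 else 0)" for m'
  proof (cases "keys m' \<subseteq> A")
    case True
    then have "monom_eval ?s m' = monom_eval Var m'" by (intro monom_eval_cong) auto
    then show ?thesis using True by (simp add: monom_eval_Var)
  next
    case False
    then obtain x where "x \<in> keys m'" "x \<notin> A" by auto
    then have "monom_eval ?s m' = 0" unfolding monom_eval_def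
      by (intro prod_zero bexI[of _ x]) (simp_all add: in_keys_iff zero_power)
    then show ?thesis using False by simp
  qed
  then have "lookup (peval Const ?s f) m =
      (\<Sum>m'\<in>keys f. if m' = m then (if keys m \<subseteq> A then lookup f m else 0) else 0)"
    unfolding peval_def lookup_sum
    by (intro sum.cong refl) (auto simp: lookup_Const_times lookup_single when_def)
  then show ?thesis by (auto simp: in_keys_iff)
qed

text \<open>The coefficient type still contains all variables. So coefficients can be compared with
  the Hilbert ideal of the full ring, and T - x can be formed.\<close>

definition separate :: "'x set \<Rightarrow> ('x, 'k::comm_ring_1) mpoly \<Rightarrow> ('x, ('x, 'k) mpoly) mpoly" where
  "separate Z = peval (\<lambda>c. Const (Const c)) (\<lambda>x. if x \<in> Z then Var x else Const (Var x))"

lemma ring_map_separate: "ring_map (separate Z)"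
  unfolding separate_def by (rule ring_map.ring_map_peval[OF ring_map_Const_Const])

lemma separate_Const: "separate Z (Const c) = Const (Const c)"
  unfolding separate_def by (rule ring_map.peval_Const[OF ring_map_Const_Const])

lemma separate_Var: "separate Z (Var x) = (if x \<in> Z then Var x else Const (Var x))"
  unfolding separate_def by (rule ring_map.peval_Var[OF ring_map_Const_Const])

lemma lookup_Var: "lookup (Var x) m = (if m = single x 1 then 1 else 0)"
  by (auto simp: Var_def lookup_single when_def)

text \<open>f(T) = f(x + (T - x)): substituting t = T - x turns control over the Taylor coefficients
  into control over the coefficients of f as a polynomial in the variables of
  \<open>Z\<close>.\<close>

lemma separate_eq_taylor: "separate Z f = peval Const (\<lambda>x. Var x - Const (Var x)) (taylor Z f)"
  by (rule ring_map_ext[OF ring_map_separate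
        ring_map_comp[OF ring_map.ring_map_peval[OF ring_map_Const] ring_map_taylor], where I = UNIV])
    (auto simp: taylor_Const taylor_Var mem_polys_iff separate_Const separate_Var
      ring_map.peval_add[OF ring_map_Const]
      ring_map.peval_Const[OF ring_map_Const] ring_map.peval_Var[OF ring_map_Const])

lemma peval_separate: "peval (\<lambda>c. c) Var (separate Z f) = f"
  by (rule ring_map_ext[OF ring_map_comp[OF ring_map.ring_map_peval[OF ring_map_ident] ring_map_separate]
        ring_map_ident, where I = UNIV])
    (auto simp: separate_Const separate_Var mem_polys_iff
      ring_map.peval_Const[OF ring_map_ident] ring_map.peval_Var[OF ring_map_ident])

lemma separate_eq_Const:
  assumes "f \<in> polys (- Z)" shows "separate Z f = Const f"
  by (rule ring_map_ext[OF ring_map_separate ring_map_Const _ _ assms])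
    (simp_all add: separate_Const separate_Var)

lemma lookup_separate_polys:
  assumes "f \<in> polys I"
  shows "lookup (separate Z f) \<beta> \<in> polys (I - Z)"
  using assms
proof (induction f arbitrary: \<beta> rule: polys_induct)
  case (add f g)
  then show ?case by (simp add: ring_map.add[OF ring_map_separate] lookup_add polys_add)
next
  case (mult f g)
  have "separate Z f * separate Z g =
      (\<Sum>\<gamma>\<in>keys (separate Z f). single \<gamma> (lookup (separate Z f) \<gamma>) * separate Z g)"
    by (subst (1) poly_mapping_sum_single[of "separate Z f"]) (simp add: sum_distrib_right)
  then show ?case
    by (auto simp: ring_map.mult[OF ring_map_separate] lookup_sum lookup_single_times
        intro!: polys_sum polys_mult mult)
qed (auto simp: separate_Const separate_Var lookup_Const lookup_Var intro: polys_Var)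

lemma keys_separate:
  assumes "f \<in> polys I" "\<beta> \<in> keys (separate Z f)"
  shows "keys \<beta> \<subseteq> I \<inter> Z"
proof -
  have "separate Z f \<in> polys (I \<inter> Z)"
    unfolding separate_def using assms(1) by (rule polys_peval) (auto intro: polys_Var)
  then show ?thesis using assms(2) by (simp add: mem_polys_iff)
qed

section \<open>The Hilbert ideal\<close>

lemma minus_mpoly_ring:
  assumes "f \<in> polys I" shows "\<ominus>\<^bsub>mpoly_ring I\<^esub> f = - f"
proof -
  interpret cring "mpoly_ring I :: ('a, 'b) mpoly ring" by (rule mpoly_ring_cring)
  show ?thesis using assms by (intro minus_equality) (simp_all add: polys_uminus)
qed

lemma ideal_mpoly_ringI:
  fixes J :: "('x, 'k::comm_ring_1) mpoly set"
  assumes "J \<subseteq> polys I" "0 \<in> J" "\<And>f g. f \<in> J \<Longrightarrow> g \<in> J \<Longrightarrow> f + g \<in> J"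
    and mult: "\<And>f g. f \<in> polys I \<Longrightarrow> g \<in> J \<Longrightarrow> f * g \<in> J"
  shows "ideal J (mpoly_ring I)"
proof (rule idealI)
  interpret cring "mpoly_ring I :: ('x, 'k) mpoly ring" by (rule mpoly_ring_cring)
  show "ring (mpoly_ring I :: ('x, 'k) mpoly ring)" by (rule ring_axioms)
  show "subgroup J (add_monoid (mpoly_ring I))"
  proof (rule add.subgroupI)
    fix f assume f: "f \<in> J"
    have "- 1 * f \<in> J" using mult[OF polys_uminus[OF polys_1] f] .
    moreover have "f \<in> polys I" using f assms(1) by blast
    ultimately show "\<ominus>\<^bsub>mpoly_ring I\<^esub> f \<in> J" by (simp add: minus_mpoly_ring)
  qed (use assms in auto)
  fix f g :: "('x, 'k) mpoly" assume fg: "g \<in> polys I" "f \<in> J"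
  show "g \<otimes>\<^bsub>mpoly_ring I\<^esub> f \<in> J" using mult[OF fg] by simp
  show "f \<otimes>\<^bsub>mpoly_ring I\<^esub> g \<in> J" using mult[OF fg] by (simp add: mult.commute)
qed

lemma CHAR_mpoly [simp]: "CHAR(('x, 'k::comm_ring_1) mpoly) = CHAR('k)"
proof (rule CHAR_eqI)
  show "of_nat CHAR('k) = (0 :: ('x, 'k) mpoly)"
    by (simp flip: single_of_nat)
  fix l assume "of_nat l = (0 :: ('x, 'k) mpoly)"
  then have "lookup (of_nat l :: ('x, 'k) mpoly) 0 = 0" by simp
  then show "CHAR('k) dvd l" by (simp add: lookup_of_nat of_nat_eq_0_iff_char_dvd)
qed

text \<open>What remains of the representation: one substitution whose fixed polynomials generate
  \<open>H\<close>, and exponents \<open>\<alpha>\<close> described by two inequalities.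
  \<open>n_le_\<alpha>\<close> serves the norm, \<open>less_n\<close> the exclusion of reduced
  monomials.\<close>

locale jordan_coinvariants =
  fixes p k r :: nat and n \<alpha> :: "nat \<Rightarrow> nat" and H :: "(nat \<times> nat, 'k::field) mpoly set"
  assumes prime_p: "Factorial_Ring.prime p" and CHAR_eq: "CHAR('k) = p"
    and n_ge_1: "\<And>i. i \<le> k \<Longrightarrow> 1 \<le> n i" and n_le: "\<And>i. i \<le> k \<Longrightarrow> n i \<le> p ^ r"
    and n_le_\<alpha>: "\<And>i. i \<le> k \<Longrightarrow> n i \<le> p ^ \<alpha> i"
    and less_n: "\<And>i s. i \<le> k \<Longrightarrow> s < \<alpha> i \<Longrightarrow> p ^ s < n i"
    and H_eq: "H = Idl\<^bsub>mpoly_ring (jordan_index k n)\<^esub>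
      {f \<in> polys (jordan_index k n). jordan_map f = f \<and> (\<exists>d>0. homogeneous d f)}"
begin

abbreviation "I \<equiv> jordan_index k n"
abbreviation "terminal i \<equiv> (n i, i)"
abbreviation "Z \<equiv> terminal ` {..k}"
abbreviation "q i \<equiv> p ^ \<alpha> i"

text \<open>Exponents of the monomials that turn out to be a basis of the subalgebra generated by
  the terminal variables.\<close>

definition reduced :: "(nat \<times> nat \<Rightarrow>\<^sub>0 nat) set" where
  "reduced = {\<beta>. keys \<beta> \<subseteq> Z \<and> (\<forall>i\<le>k. lookup \<beta> (terminal i) < q i)}"

lemma Z_I: "Z \<subseteq> I"
  using n_ge_1 by (auto simp: jordan_index_def)

lemma q_pos: "0 < q i"
  using prime_gt_0_nat[OF prime_p] by simp

lemma H_ideal: "ideal H (mpoly_ring I)"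
  unfolding H_eq
  by (intro ring.genideal_ideal cring.axioms(1) mpoly_ring_cring) auto

lemma H_minimal:
  assumes "ideal J (mpoly_ring I)"
    "\<And>f d. f \<in> polys I \<Longrightarrow> jordan_map f = f \<Longrightarrow> 0 < d \<Longrightarrow> homogeneous d f \<Longrightarrow> f \<in> J"
  shows "H \<subseteq> J"
  unfolding H_eq using assms
  by (intro ring.genideal_minimal cring.axioms(1) mpoly_ring_cring) auto

lemma invariant_in_H:
  "f \<in> polys I \<Longrightarrow> jordan_map f = f \<Longrightarrow> 0 < d \<Longrightarrow> homogeneous d f \<Longrightarrow> f \<in> H"
  unfolding H_eq
  by (rule subsetD[OF ring.genideal_self[OF cring.axioms(1)[OF mpoly_ring_cring]]]) auto

lemma H_polys: "f \<in> H \<Longrightarrow> f \<in> polys I"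
  using ideal.Icarr[OF H_ideal] .

lemma H_0: "0 \<in> H"
  using additive_subgroup.zero_closed[OF ideal.axioms(1)[OF H_ideal]] by simp

lemma H_add: "f \<in> H \<Longrightarrow> g \<in> H \<Longrightarrow> f + g \<in> H"
  using additive_subgroup.a_closed[OF ideal.axioms(1)[OF H_ideal], of f g] by simp

lemma H_mult: "f \<in> polys I \<Longrightarrow> g \<in> H \<Longrightarrow> f * g \<in> H"
  using ideal.I_l_closed[OF H_ideal, of g f] by simp

lemma H_uminus: "f \<in> H \<Longrightarrow> - f \<in> H"
  using H_mult[of "- 1" f] polys_uminus[OF polys_1, of I] by simp

lemma H_sum: "(\<And>i. i \<in> A \<Longrightarrow> g i \<in> H) \<Longrightarrow> sum g A \<in> H"
  by (induction A rule: infinite_finite_induct) (simp_all add: H_0 H_add)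

text \<open>The polynomials without constant term form an ideal containing all generators; in
  particular \<open>H\<close> is proper.\<close>

lemma lookup_0_H: "f \<in> H \<Longrightarrow> lookup f 0 = 0"
proof -
  let ?J = "{f \<in> polys I. lookup f 0 = (0::'k)}"
  have "H \<subseteq> ?J"
  proof (rule H_minimal)
    show "ideal ?J (mpoly_ring I)"
      by (rule ideal_mpoly_ringI)
        (auto simp: lookup_add ring_map.mult[OF ring_map_lookup_0] intro: polys_add polys_mult)
    fix f :: "(nat \<times> nat, 'k) mpoly" and d :: nat
    assume "f \<in> polys I" "0 < d" "homogeneous d f"
    then have "0 \<notin> keys f" by (metis homogeneous_iff less_irrefl mdeg_0)
    then show "f \<in> ?J" using \<open>f \<in> polys I\<close> by (simp add: in_keys_iff)
  qed
  then show "f \<in> H \<Longrightarrow> lookup f 0 = 0" by auto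
qed

lemma Const_in_H_iff: "Const c \<in> H \<longleftrightarrow> c = 0"
  using lookup_0_H[of "Const c"] H_0 by (auto simp: lookup_Const)

text \<open>The substitution changes each variable by 0 or by the variable of index j - 1 in its
  block, which is never terminal because j - 1 < n_i. So it commutes with translating terminal
  variables.\<close>

lemma lookup_taylor_invariant:
  assumes "f \<in> polys I" "jordan_map f = f" "Z' \<subseteq> Z"
  shows "jordan_map (lookup (taylor Z' f) \<beta>) = lookup (taylor Z' f) \<beta>"
proof -
  have "jordan_var x - Var x \<in> polys (- Z')" if "x \<in> I" for x
    using that assms(3) unfolding jordan_var_def
    by (auto simp: jordan_index_def intro!: polys_Var)
  from lookup_taylor_subst[OF this assms(1), of \<beta>] assms(2) show ?thesis by simp
qed

lemma finite_subset_Z: "Z' \<subseteq> Z \<Longrightarrow> finite Z'"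
  by (rule finite_subset) auto

text \<open>Below degree d the coefficient is an invariant of positive degree d - |\<beta>|, above
  it vanishes. Only the constants in degree d escape.\<close>

lemma lookup_taylor_in_H:
  assumes f: "f \<in> polys I" "jordan_map f = f" "homogeneous d f" "Z' \<subseteq> Z" and "mdeg \<beta> \<noteq> d"
  shows "lookup (taylor Z' f) \<beta> \<in> H"
proof (cases "mdeg \<beta> < d")
  case True
  show ?thesis
    by (rule invariant_in_H[of _ "d - mdeg \<beta>"])
      (use finite_subset_Z[OF f(4)] f True in \<open>auto intro: lookup_taylor_polys lookup_taylor_invariant
        homogeneous_lookup_taylor\<close>)
next
  case False
  then show ?thesis
    using lookup_taylor_eq_0[OF finite_subset_Z[OF f(4)] f(3), of \<beta>] assms(5) H_0 by simp
qed

text \<open>If \<open>p\<^bsup>s\<^esup>\<close> is the \<open>p\<close>-part of the exponent of a terminal variable in \<open>\<beta>\<close>, the Taylor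
  coefficient at \<open>\<beta>\<close> with that exponent lowered by \<open>p\<^bsup>s\<^esup>\<close> is an invariant of degree \<open>p\<^bsup>s\<^esup>\<close>, small
  enough for the Chevalley--Warning argument.\<close>

lemma invariant_lookup_reduced:
  fixes f :: "(nat \<times> nat, 'k) mpoly"
  assumes f: "f \<in> polys I" "jordan_map f = f" "homogeneous d f" "0 < d"
    and \<beta>: "\<beta> \<in> reduced" "mdeg \<beta> = d"
  shows "lookup f \<beta> = 0"
proof -
  have keys: "keys \<beta> \<subseteq> Z" using \<beta>(1) by (simp add: reduced_def)
  have "keys \<beta> \<noteq> {}" using \<beta>(2) f(4) unfolding mdeg_def by (metis less_irrefl sum.empty)
  then obtain y where "y \<in> keys \<beta>" by blast
  then obtain i where i: "i \<le> k" "terminal i \<in> keys \<beta>" using keys by blast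
  define x where "x = terminal i"
  define b where "b = lookup \<beta> x"
  define s where "s = multiplicity p b"
  have b: "0 < b" "b < q i" using i \<beta>(1) by (auto simp: b_def x_def in_keys_iff reduced_def)
  have "\<not> is_unit p" using prime_gt_1_nat[OF prime_p] by simp
  then obtain m where m: "b = p ^ s * m" "\<not> p dvd m"
    using multiplicity_decompose'[of b p] b(1) unfolding s_def by auto
  have "m \<noteq> 0" using m(2) by (metis dvd_0_right)
  have ps: "p ^ s \<le> b" unfolding m(1) using \<open>m \<noteq> 0\<close> by simp
  then have "p ^ s < p ^ \<alpha> i" using b(2) by simp
  then have "s < \<alpha> i" using prime_gt_1_nat[OF prime_p] by simp
  then have "p ^ s < n i" by (rule less_n[OF i(1)])
  let ?x = "single x (p ^ s)"
  let ?g = "lookup (taylor Z f) (\<beta> - ?x)"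
  have \<beta>_eq: "?x + (\<beta> - ?x) = \<beta>"
    using ps unfolding b_def
    by (intro poly_mapping_eqI) (auto simp: lookup_add lookup_minus lookup_single when_def)
  then have "mdeg \<beta> = p ^ s + mdeg (\<beta> - ?x)" by (metis mdeg_add mdeg_single)
  then have deg: "d - mdeg (\<beta> - ?x) = p ^ s" using \<beta>(2) by simp
  have g: "homogeneous (p ^ s) ?g"
    using homogeneous_lookup_taylor[OF _ f(3), of Z "\<beta> - ?x"] unfolding deg by simp
  have g': "?g \<in> polys I" "jordan_map ?g = ?g"
    using f lookup_taylor_polys[of Z f I] lookup_taylor_invariant[of f Z] by auto
  have "lookup ?g (single (terminal i) (p ^ s)) = 0"
    by (rule invariant_lookup_terminal_power_small[where r = r and k = k, OF _ _ g' g])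
      (use prime_p n_le[OF i(1)] \<open>p ^ s < n i\<close> prime_gt_0_nat[OF prime_p] in \<open>simp_all add: CHAR_eq\<close>)
  then have "lookup ?g ?x = 0" by (simp add: x_def)
  moreover have "keys (\<beta> - ?x) \<subseteq> Z" using keys by (auto simp: in_keys_iff lookup_minus)
  \<comment> \<open>The coefficient of the p^s-th power of \<open>x\<close> in \<open>?g\<close> is
    a binomial multiple of the coefficient of \<open>\<beta>\<close> in \<open>f\<close>; it remains
    to see that the multiple is nonzero.\<close>
  ultimately have 0: "of_nat (choose_prod Z ?x (\<beta> - ?x)) * lookup f \<beta> = 0"
    by (simp add: lookup_lookup_taylor \<beta>_eq)
  have "choose_prod Z ?x (\<beta> - ?x) = (p ^ s * m choose (b - p ^ s)) * choose_prod (Z - {x}) ?x (\<beta> - ?x)"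
    using choose_prod_remove[of Z x ?x "\<beta> - ?x"] i(1) ps unfolding m(1)[symmetric]
    by (simp add: x_def[symmetric] lookup_minus b_def[symmetric]) (simp add: x_def)
  also have "choose_prod (Z - {x}) ?x (\<beta> - ?x) = 1"
    unfolding choose_prod_def by (intro prod.neutral) (auto simp: lookup_single when_def)
  also have "(p ^ s * m choose (b - p ^ s)) = (p ^ s * m choose p ^ s)"
    unfolding m(1) using binomial_symmetric[of "p ^ s" "p ^ s * m"] \<open>m \<noteq> 0\<close> by simp
  finally have C: "choose_prod Z ?x (\<beta> - ?x) = (p ^ s * m choose p ^ s)" by simp
  \<comment> \<open>This binomial coefficient has the same p-part as m, a fact familiar from the
    proof of Sylow's theorem, and p does not divide m.\<close>
  have "multiplicity p (p ^ s * m choose p ^ s) = 0"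
    using const_p_fac[of m p s] \<open>m \<noteq> 0\<close> prime_p m(2) by (simp add: not_dvd_imp_multiplicity_0)
  moreover have "(p ^ s * m choose p ^ s) \<noteq> 0" using \<open>m \<noteq> 0\<close> by simp
  ultimately have "\<not> p dvd (p ^ s * m choose p ^ s)"
    using \<open>\<not> is_unit p\<close> by (simp add: multiplicity_eq_zero_iff)
  then have "(of_nat (choose_prod Z ?x (\<beta> - ?x)) :: 'k) \<noteq> 0"
    unfolding C by (simp only: of_nat_eq_0_iff_char_dvd CHAR_eq not_False_eq_True)
  then show ?thesis using 0 by simp
qed

text \<open>One step acts on the variables of a block as \<open>shift\<close>. Additivity of the
  substitution lets its iterates pass through \<open>shift\<close>, so \<open>shift_funpow\<close>
  applies.\<close>

lemma jordan_map_funpow_Var: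
  assumes "1 \<le> j"
  shows "(jordan_map ^^ l) (Var (j, i) :: (nat \<times> nat, 'k) mpoly) =
    (\<Sum>j'<j. of_nat (l choose j') * Var (j - j', i))"
proof -
  define g where "g j = (Var (j, i) :: (nat \<times> nat, 'k) mpoly)" for j
  interpret ring_map "jordan_map :: (nat \<times> nat, 'k) mpoly \<Rightarrow> _"
    by (rule ring_map.ring_map_peval[OF ring_map_Const])
  have add: "(jordan_map ^^ l) (u + v) = (jordan_map ^^ l) u + (jordan_map ^^ l) v"
    for u v :: "(nat \<times> nat, 'k) mpoly" and l
    by (induction l) simp_all
  have 1: "jordan_map (g j) = shift g j" for j
    by (simp add: g_def shift_def jordan_var_def ring_map.peval_Var[OF ring_map_Const])
  have "(jordan_map ^^ l) (g j) = (shift ^^ l) g j"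
    using assms
  proof (induction l arbitrary: j)
    case (Suc l)
    have "(jordan_map ^^ Suc l) (g j) = (jordan_map ^^ l) (shift g j)"
      unfolding funpow_Suc_right comp_apply 1 ..
    also have "\<dots> = shift (\<lambda>j. (jordan_map ^^ l) (g j)) j"
      by (simp add: shift_def add)
    also have "\<dots> = shift ((shift ^^ l) g) j"
      by (intro shift_cong Suc.IH) (use Suc.prems in auto)
    finally show ?case by simp
  qed simp
  then show ?thesis using shift_funpow[OF assms, of l g] by (simp add: g_def)
qed

text \<open>The norm \<open>N\<close> of a terminal variable \<open>x\<close>: since \<open>N\<close> is divisible by \<open>x\<close> and monic of degree \<open>q\<close> in \<open>x\<close>,
  its Taylor expansion at \<open>t = -x\<close> expresses \<open>0\<close> as \<open>(-x)\<^sup>q\<close> plus multiples of invariants of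
  positive degree.\<close>

lemma terminal_power_in_H:
  assumes i: "i \<le> k" shows "Var (terminal i) ^ q i \<in> H"
proof -
  let ?x = "terminal i" and ?q = "q i"
  define u where "u l = (jordan_map ^^ l) (Var ?x :: (nat \<times> nat, 'k) mpoly)" for l
  \<comment> \<open>The q_i-th iterate of the terminal variable is the variable again, so the
    substitution permutes these factors cyclically.\<close>
  define N where "N = (\<Prod>l<?q. u l)"
  have u: "u l = (\<Sum>j<n i. of_nat (l choose j) * Var (n i - j, i))" for l
    unfolding u_def by (rule jordan_map_funpow_Var[OF n_ge_1[OF i]])
  have u_Const: "u l = (\<Sum>j<n i. Const (of_nat (l choose j)) * Var (n i - j, i))" for l
    unfolding u ring_map.of_nat[OF ring_map_Const] ..
  have u_polys: "u l \<in> polys I" for l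
    unfolding u_Const using i by (intro polys_sum polys_mult polys_Const polys_Var) (auto simp: jordan_index_def)
  have u_hom: "homogeneous 1 (u l)" for l
    unfolding u_Const by (intro homogeneous_sum homogeneous_Const_times homogeneous_Var)
  have "u ?q = u 0"
  proof -
    have "\<forall>j\<in>{..<n i} - {0}. of_nat (?q choose j) * Var (n i - j, i) = (0 :: (nat \<times> nat, 'k) mpoly)"
    proof
      fix j assume j: "j \<in> {..<n i} - {0}"
      then have "p dvd (?q choose j)"
        using prime_dvd_choose_prime_power[OF prime_p, of j "\<alpha> i"] n_le_\<alpha>[OF i] by auto
      then have "of_nat (?q choose j) = (0 :: (nat \<times> nat, 'k) mpoly)"
        by (simp only: of_nat_eq_0_iff_char_dvd CHAR_mpoly CHAR_eq)
      then show "of_nat (?q choose j) * Var (n i - j, i) = (0 :: (nat \<times> nat, 'k) mpoly)" by simp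
    qed
    then have "u ?q = (\<Sum>j\<in>{0}. of_nat (?q choose j) * Var (n i - j, i))"
      unfolding u using n_ge_1[OF i] by (intro sum.mono_neutral_right) auto
    then show ?thesis by (simp add: u_def)
  qed
  have "jordan_map N = (\<Prod>l<?q. u (Suc l))"
    unfolding N_def ring_map.prod[OF ring_map.ring_map_peval[OF ring_map_Const]] u_def by simp
  then have N_inv: "jordan_map N = N"
  proof -
    obtain Q where Q: "?q = Suc Q" using q_pos[of i] by (cases ?q) auto
    show ?thesis
      using \<open>jordan_map N = _\<close> \<open>u ?q = u 0\<close> unfolding N_def Q prod.lessThan_Suc_shift[of u]
      by (simp add: mult.commute)
  qed
  have N: "N \<in> polys I" "homogeneous ?q N"
    unfolding N_def using homogeneous_prod[of "{..<?q}" u] u_hom by (auto intro!: polys_prod u_polys)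
  have x_Z: "{?x} \<subseteq> Z" using i by auto
  let ?t = "taylor {?x} N" and ?s = "\<lambda>x. - Var x :: (nat \<times> nat, 'k) mpoly"
  \<comment> \<open>Setting all other variables to 0 turns every factor into the terminal variable,
    so \<open>N\<close> is monic in it.\<close>
  have lookup_N: "lookup N (single ?x ?q) = 1"
  proof -
    let ?e = "peval Const (\<lambda>x. if x \<in> {?x} then Var x else (0 :: (nat \<times> nat, 'k) mpoly))"
    interpret e: ring_map ?e by (rule ring_map.ring_map_peval[OF ring_map_Const])
    have "?e (u l) = (\<Sum>j<n i. if j = 0 then Var ?x else 0)" for l
      unfolding u e.sum e.mult e.of_nat by (intro sum.cong refl) (auto simp: ring_map.peval_Var[OF ring_map_Const])
    then have "?e N = Var ?x ^ ?q" using n_ge_1[OF i] unfolding N_def e.prod by simp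
    also have "\<dots> = monom_eval Var (single ?x ?q)" by simp
    also have "\<dots> = single (single ?x ?q) 1" by (rule monom_eval_Var)
    finally have "lookup (?e N) (single ?x ?q) = 1" by simp
    then show ?thesis by (simp only: lookup_zero_out split: if_splits) (simp split: if_splits)
  qed
  have "(0 :: (nat \<times> nat, 'k) mpoly) = peval Const (\<lambda>x. if x \<in> {?x} then 0 else Var x) N"
  proof -
    interpret e: ring_map "peval Const (\<lambda>x. if x \<in> {?x} then 0 else Var x :: (nat \<times> nat, 'k) mpoly)"
      by (rule ring_map.ring_map_peval[OF ring_map_Const])
    show ?thesis unfolding N_def e.prod
      by (rule sym, rule prod_zero)
        (auto intro!: bexI[of _ 0] simp: u_def ring_map.peval_Var[OF ring_map_Const] prime_gt_0_nat[OF prime_p])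
  qed
  also have "\<dots> = peval (\<lambda>c. c) ?s ?t" by (rule peval_uminus_taylor[symmetric])
  also have "\<dots> = (\<Sum>\<delta>\<in>keys ?t. lookup ?t \<delta> * monom_eval ?s \<delta>)" by (simp add: peval_def)
  also have "\<dots> = (\<Sum>\<delta>\<in>insert (single ?x ?q) (keys ?t). lookup ?t \<delta> * monom_eval ?s \<delta>)"
    by (rule sum.mono_neutral_left) (auto simp: in_keys_iff)
  also have "\<dots> = ?s ?x ^ ?q + (\<Sum>\<delta>\<in>keys ?t - {single ?x ?q}. lookup ?t \<delta> * monom_eval ?s \<delta>)"
    using lookup_taylor_top_degree[of "{?x}" "single ?x ?q" N] N lookup_N
    by (subst sum.insert_remove) simp_all
  finally have "?s ?x ^ ?q = - (\<Sum>\<delta>\<in>keys ?t - {single ?x ?q}. lookup ?t \<delta> * monom_eval ?s \<delta>)"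
    by (simp add: eq_neg_iff_add_eq_0)
  also have "\<dots> \<in> H"
  proof (intro H_uminus H_sum)
    fix \<delta> assume \<delta>: "\<delta> \<in> keys ?t - {single ?x ?q}"
    then have keys: "keys \<delta> \<subseteq> {?x}" using keys_taylor[of "{?x}" \<delta> N] by simp
    \<comment> \<open>With a single translated variable, an exponent different from q_i has a total
      degree different from q_i, so \<open>lookup_taylor_in_H\<close> covers all remaining
      terms.\<close>
    then have \<delta>_eq: "\<delta> = single ?x (lookup \<delta> ?x)" by (rule eq_single_if_keys_subset)
    then have "mdeg \<delta> \<noteq> ?q" using \<delta> by (metis DiffE mdeg_single singletonI)
    then have "lookup ?t \<delta> \<in> H" by (rule lookup_taylor_in_H[OF N(1) N_inv N(2) x_Z])
    moreover have "monom_eval ?s \<delta> \<in> polys I"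
      using keys Z_I x_Z by (intro polys_monom_eval polys_uminus polys_Var) auto
    ultimately show "lookup ?t \<delta> * monom_eval ?s \<delta> \<in> H" by (simp add: H_mult mult.commute)
  qed
  finally have "(- Var ?x) ^ ?q \<in> H" .
  then have "(- 1) ^ ?q * (- Var ?x) ^ ?q \<in> H"
    by (rule H_mult[rotated]) (intro polys_power polys_uminus polys_1)
  then show ?thesis by (simp flip: power_mult_distrib)
qed

end

text \<open>A basis of \<open>W\<close> is extended to one of \<open>U\<close>; the added vectors
  are a basis of the quotient of \<open>U\<close> by \<open>W\<close>, expressed here without
  forming it.\<close>

lemma (in vector_space) basis_mod_subspace:
  assumes U: "subspace U" and W: "subspace W" "W \<subseteq> U"
  obtains B where "B \<subseteq> U"
    and "\<And>u. u \<in> U \<Longrightarrow> \<exists>F c. finite F \<and> F \<subseteq> B \<and> u - (\<Sum>b\<in>F. scale (c b) b) \<in> W"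
    and "\<And>F c b. finite F \<Longrightarrow> F \<subseteq> B \<Longrightarrow> (\<Sum>b\<in>F. scale (c b) b) \<in> W \<Longrightarrow> b \<in> F \<Longrightarrow> c b = 0"
proof -
  obtain B0 where B0: "B0 \<subseteq> W" "independent B0" "W \<subseteq> span B0"
    using maximal_independent_subset by metis
  obtain B1 where B1: "B0 \<subseteq> B1" "B1 \<subseteq> U" "independent B1" "U \<subseteq> span B1"
    using maximal_independent_subset_extend[of B0 U] B0 W(2) by (metis subset_trans)
  show thesis
  proof (rule that[of "B1 - B0"])
    show "B1 - B0 \<subseteq> U" using B1 by auto
  next
    fix u assume "u \<in> U"
    then obtain t c where t: "finite t" "t \<subseteq> B1" "u = (\<Sum>a\<in>t. scale (c a) a)"
      using B1(4) unfolding span_explicit by blast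
    have "u - (\<Sum>a\<in>t - B0. scale (c a) a) = (\<Sum>a\<in>t \<inter> B0. scale (c a) a)"
      unfolding t(3) using t(1) by (subst sum.Int_Diff[of t _ B0]) auto
    moreover have "(\<Sum>a\<in>t \<inter> B0. scale (c a) a) \<in> W"
      using B0(1) by (intro subspace_sum subspace_scale W(1)) auto
    ultimately show "\<exists>F c. finite F \<and> F \<subseteq> B1 - B0 \<and> u - (\<Sum>b\<in>F. scale (c b) b) \<in> W"
      using t by (intro exI[of _ "t - B0"] exI[of _ c]) auto
  next
    fix F c b
    assume F: "finite F" "F \<subseteq> B1 - B0" "(\<Sum>b\<in>F. scale (c b) b) \<in> W" "b \<in> F"
    then have "(\<Sum>b\<in>F. scale (c b) b) \<in> span B0" using B0(3) by auto
    then obtain t d where t: "finite t" "t \<subseteq> B0" "(\<Sum>b\<in>F. scale (c b) b) = (\<Sum>a\<in>t. scale (d a) a)"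
      unfolding span_explicit by blast
    let ?g = "\<lambda>v. if v \<in> F then c v else - d v"
    have "(\<Sum>v\<in>F \<union> t. scale (?g v) v) = (\<Sum>v\<in>F. scale (?g v) v) + (\<Sum>v\<in>t. scale (?g v) v)"
      using F t by (intro sum.union_disjoint) auto
    also have "(\<Sum>v\<in>t. scale (?g v) v) = (\<Sum>v\<in>t. - scale (d v) v)"
      using F(2) t(2) by (intro sum.cong refl) auto
    also have "(\<Sum>v\<in>F. scale (?g v) v) + (\<Sum>v\<in>t. - scale (d v) v) = 0"
      using t(3) by (simp add: sum_negf)
    finally have "?g b = 0"
      using B1(1,3) F t by (intro independentD[of B1 "F \<union> t" ?g b]) auto
    then show "c b = 0" using F(4) by simp
  qed
qed

lemma vector_space_Const: "vector_space (\<lambda>(c::'k::field) (f :: ('x, 'k) mpoly). Const c * f)"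
  by standard (simp_all add: distrib_left distrib_right ring_map.add[OF ring_map_Const]
      ring_map.mult[OF ring_map_Const] mult.assoc)

section \<open>Coefficients of ideal elements with respect to the terminal variables\<close>

context jordan_coinvariants
begin

lemma reduced_add: "\<gamma> + \<delta> \<in> reduced \<Longrightarrow> \<delta> \<in> reduced"
  by (auto simp: reduced_def keys_add_nat lookup_add intro: le_less_trans)

text \<open>Those two-level polynomials that fall into \<open>H\<close> coefficientwise once the
  non-reduced outer monomials are dropped. This is the ideal into which \<open>separate Z\<close>
  has to map \<open>H\<close>.\<close>

definition vanishing :: "(nat \<times> nat, (nat \<times> nat, 'k) mpoly) mpoly set" where
  "vanishing = {F. (\<forall>\<beta>. lookup F \<beta> \<in> polys I) \<and> (\<forall>\<beta>\<in>reduced. lookup F \<beta> \<in> H)}"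

lemma vanishing_0: "0 \<in> vanishing"
  by (simp add: vanishing_def H_0)

lemma vanishing_add: "F \<in> vanishing \<Longrightarrow> G \<in> vanishing \<Longrightarrow> F + G \<in> vanishing"
  by (simp add: vanishing_def lookup_add H_add polys_add)

lemma vanishing_sum: "(\<And>i. i \<in> A \<Longrightarrow> g i \<in> vanishing) \<Longrightarrow> sum g A \<in> vanishing"
  by (induction A rule: infinite_finite_induct) (simp_all add: vanishing_0 vanishing_add)

text \<open>Multiplying by an outer monomial moves the coefficient at \<beta> - \<gamma> to \<beta>,
  and what divides a reduced monomial is reduced (\<open>reduced_add\<close>).\<close>

lemma vanishing_mult:
  assumes G: "\<And>\<beta>. lookup G \<beta> \<in> polys I" and F: "F \<in> vanishing"
  shows "G * F \<in> vanishing"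
proof -
  have "G * F = (\<Sum>\<gamma>\<in>keys G. single \<gamma> (lookup G \<gamma>) * F)"
    by (subst (1) poly_mapping_sum_single[of G]) (simp add: sum_distrib_right)
  also have "\<dots> \<in> vanishing"
  proof (rule vanishing_sum)
    fix \<gamma>
    have "lookup F (\<beta> - \<gamma>) \<in> H" if "\<beta> \<in> reduced" "\<beta> = \<gamma> + l" for \<beta> l
      using that F reduced_add[of \<gamma> l] by (simp add: vanishing_def)
    then show "single \<gamma> (lookup G \<gamma>) * F \<in> vanishing"
      using G F by (auto simp: vanishing_def lookup_single_times H_0 intro!: polys_mult H_mult)
  qed
  finally show ?thesis .
qed

lemma vanishing_Const: "f \<in> H \<Longrightarrow> Const f \<in> vanishing"
  by (simp add: vanishing_def lookup_Const H_0 H_polys)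

lemma Var_power_eq: "Var x ^ d = (single (single x d) 1 :: ('x, 'a::comm_ring_1) mpoly)"
  using monom_eval_Var[of "single x d"] by simp

text \<open>By the Frobenius map this is T^q + (-x)^q. The first exponent is not reduced, and the
  second term lies in \<open>H\<close> by \<open>terminal_power_in_H\<close>.\<close>

lemma vanishing_terminal:
  assumes i: "i \<le> k"
  shows "(Var (terminal i) - Const (Var (terminal i))) ^ q i \<in> vanishing"
proof -
  let ?x = "terminal i"
  have "Factorial_Ring.prime CHAR((nat \<times> nat, (nat \<times> nat, 'k) mpoly) mpoly)"
    using prime_p by (simp add: CHAR_eq)
  then have "(Var ?x - Const (Var ?x)) ^ q i =
      Var ?x ^ q i + (- Const (Var ?x) :: (nat \<times> nat, (nat \<times> nat, 'k) mpoly) mpoly) ^ q i"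
    using freshmans_dream'[of "q i" "\<alpha> i" "Var ?x" "- Const (Var ?x) :: (nat \<times> nat, (nat \<times> nat, 'k) mpoly) mpoly"]
    by (simp add: CHAR_eq)
  also have "\<dots> = single (single ?x (q i)) 1 + Const ((- Var ?x) ^ q i)"
    by (simp add: Var_power_eq ring_map.power[OF ring_map_Const] ring_map.uminus[OF ring_map_Const])
  also have "\<dots> \<in> vanishing"
  proof (rule vanishing_add)
    show "single (single ?x (q i)) 1 \<in> vanishing"
      using i by (auto simp: vanishing_def reduced_def lookup_single when_def H_0)
    have "(- 1) ^ q i * Var ?x ^ q i \<in> H"
      by (intro H_mult terminal_power_in_H i polys_power polys_uminus polys_1)
    then have "(- Var ?x) ^ q i \<in> H" by (simp flip: power_mult_distrib)
    then show "Const ((- Var ?x) ^ q i) \<in> vanishing" by (rule vanishing_Const)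
  qed
  finally show ?thesis .
qed

lemma not_reduced_split:
  assumes "keys \<beta> \<subseteq> Z" "\<beta> \<notin> reduced"
  obtains i \<gamma> where "i \<le> k" "\<beta> = \<gamma> + single (terminal i) (q i)"
proof -
  obtain i where i: "i \<le> k" "q i \<le> lookup \<beta> (terminal i)"
    using assms by (auto simp: reduced_def not_less)
  then have "\<beta> = \<beta> - single (terminal i) (q i) + single (terminal i) (q i)"
    by (intro poly_mapping_eqI) (auto simp: lookup_add lookup_minus lookup_single when_def)
  then show thesis using that i(1) by blast
qed

text \<open>f(T) is the sum of c_\<delta> (T - x)^\<delta>. For reduced \<delta> the coefficient
  lies in \<open>H\<close>, being zero in the top degree by \<open>invariant_lookup_reduced\<close>;
  otherwise the power contains a factor (T_i - x_i)^{q_i}, treated in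
  \<open>vanishing_terminal\<close>.\<close>

lemma separate_invariant_vanishing:
  assumes f: "f \<in> polys I" "jordan_map f = f" "homogeneous d f" "0 < d"
  shows "separate Z (f :: (nat \<times> nat, 'k) mpoly) \<in> vanishing"
proof -
  let ?s = "\<lambda>x. Var x - Const (Var x) :: (nat \<times> nat, (nat \<times> nat, 'k) mpoly) mpoly"
  have s_polys: "lookup (monom_eval ?s \<delta>) \<beta> \<in> polys I" if "keys \<delta> \<subseteq> Z" for \<delta> \<beta>
  proof -
    define C :: "(nat \<times> nat, (nat \<times> nat, 'k) mpoly) mpoly set"
      where "C = {G. \<forall>\<beta>. lookup G \<beta> \<in> polys I}"
    have mult: "F * G \<in> C" if "F \<in> C" "G \<in> C" for F G
    proof -
      have "F * G = (\<Sum>\<gamma>\<in>keys F. single \<gamma> (lookup F \<gamma>) * G)"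
        by (subst (1) poly_mapping_sum_single[of F]) (simp add: sum_distrib_right)
      then show ?thesis using that unfolding C_def
        by (auto simp: lookup_sum lookup_single_times intro!: polys_sum polys_mult)
    qed
    have one: "1 \<in> C" by (simp add: C_def lookup_one when_def)
    have "?s x \<in> C" if "x \<in> Z" for x
      using that Z_I unfolding C_def
      by (auto simp: lookup_minus lookup_Var lookup_Const intro!: polys_diff polys_uminus polys_Var)
    then have pow: "?s x ^ l \<in> C" if "x \<in> Z" for x l
      using that one mult by (induction l) simp_all
    have "(\<Prod>x\<in>A. ?s x ^ lookup \<delta> x) \<in> C" if "finite A" "A \<subseteq> Z" for A
      using that one mult pow by (induction A rule: finite_induct) simp_all
    then have "monom_eval ?s \<delta> \<in> C" using that unfolding monom_eval_def by simp
    then show ?thesis unfolding C_def by simp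
  qed
  have "separate Z f = (\<Sum>\<delta>\<in>keys (taylor Z f). Const (lookup (taylor Z f) \<delta>) * monom_eval ?s \<delta>)"
    by (simp add: separate_eq_taylor peval_def)
  also have "\<dots> \<in> vanishing"
  proof (rule vanishing_sum)
    fix \<delta> assume "\<delta> \<in> keys (taylor Z f)"
    then have keys: "keys \<delta> \<subseteq> Z" by (intro keys_taylor) auto
    show "Const (lookup (taylor Z f) \<delta>) * monom_eval ?s \<delta> \<in> vanishing"
    proof (cases "\<delta> \<in> reduced")
      case True
      have "lookup (taylor Z f) \<delta> \<in> H"
      proof (cases "mdeg \<delta> = d")
        case True
        then show ?thesis
          using lookup_taylor_top_degree[of Z \<delta> f] f keys invariant_lookup_reduced[OF f \<open>\<delta> \<in> reduced\<close>] H_0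
          by simp
      qed (use lookup_taylor_in_H[OF f(1-3)] in auto)
      then show ?thesis
        using vanishing_mult[OF s_polys[OF keys] vanishing_Const] by (subst mult.commute) simp
    next
      case False
      with keys obtain i \<gamma> where i: "i \<le> k" "\<delta> = \<gamma> + single (terminal i) (q i)"
        by (rule not_reduced_split)
      then have "keys \<gamma> \<subseteq> Z" using keys by (simp add: keys_add_nat)
      then have "Const (lookup (taylor Z f) \<delta>) * (monom_eval ?s \<gamma> * ?s (terminal i) ^ q i) \<in> vanishing"
        by (intro vanishing_mult s_polys vanishing_terminal i)
          (auto simp: lookup_Const intro: lookup_taylor_polys f)
      then show ?thesis by (simp add: i(2))
    qed
  qed
  finally show ?thesis .
qed

text \<open>The preimage of \<open>vanishing\<close> is an ideal containing the generators of
  \<open>H\<close>. Thus \<open>H\<close> is closed under taking coefficients at reduced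
  exponents.\<close>

lemma separate_H_vanishing:
  assumes "f \<in> H" shows "separate Z f \<in> vanishing"
proof -
  interpret sep: ring_map "separate Z :: (nat \<times> nat, 'k) mpoly \<Rightarrow> _" by (rule ring_map_separate)
  let ?J = "{f \<in> polys I. separate Z f \<in> vanishing}"
  have "H \<subseteq> ?J"
  proof (rule H_minimal)
    have "lookup (separate Z f) \<beta> \<in> polys I" if "f \<in> polys I" for f :: "(nat \<times> nat, 'k) mpoly" and \<beta>
      using lookup_separate_polys[OF that] by (rule polys_mono[rotated]) auto
    then show "ideal ?J (mpoly_ring I)"
      by (intro ideal_mpoly_ringI) (auto simp: vanishing_0 intro: polys_add polys_mult vanishing_add vanishing_mult)
  qed (auto intro: separate_invariant_vanishing)
  then show ?thesis using assms by auto
qed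

lemma monom_not_reduced_in_H:
  assumes "keys \<beta> \<subseteq> Z" "\<beta> \<notin> reduced"
  shows "monom_eval Var \<beta> \<in> H"
proof -
  obtain i \<gamma> where i: "i \<le> k" "\<beta> = \<gamma> + single (terminal i) (q i)"
    using not_reduced_split[OF assms] .
  then have "keys \<gamma> \<subseteq> I" using assms(1) Z_I by (auto simp: keys_add_nat)
  then have "monom_eval Var \<gamma> * Var (terminal i) ^ q i \<in> H"
    by (intro H_mult terminal_power_in_H i polys_monom_eval polys_Var) auto
  then show ?thesis by (simp add: i(2))
qed

lemma reduce_mod_H:
  assumes "f \<in> polys I"
  shows "f - (\<Sum>\<beta>\<in>keys (separate Z f) \<inter> reduced. lookup (separate Z f) \<beta> * monom_eval Var \<beta>) \<in> H"
proof -
  let ?F = "separate Z f"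
  have "f = (\<Sum>\<beta>\<in>keys ?F. lookup ?F \<beta> * monom_eval Var \<beta>)"
    using peval_separate[of Z f] by (simp add: peval_def)
  also have "\<dots> = (\<Sum>\<beta>\<in>keys ?F \<inter> reduced. lookup ?F \<beta> * monom_eval Var \<beta>) +
      (\<Sum>\<beta>\<in>keys ?F - reduced. lookup ?F \<beta> * monom_eval Var \<beta>)"
    by (rule sum.Int_Diff) simp
  finally have "f - (\<Sum>\<beta>\<in>keys ?F \<inter> reduced. lookup ?F \<beta> * monom_eval Var \<beta>) =
      (\<Sum>\<beta>\<in>keys ?F - reduced. lookup ?F \<beta> * monom_eval Var \<beta>)"
    by (simp add: algebra_simps)
  also have "\<dots> \<in> H"
  proof (intro H_sum H_mult)
    fix \<beta> assume \<beta>: "\<beta> \<in> keys ?F - reduced"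
    then have "keys \<beta> \<subseteq> Z" using keys_separate[OF assms, of \<beta> Z] by auto
    then show "monom_eval Var \<beta> \<in> H" using \<beta> by (intro monom_not_reduced_in_H) auto
    show "lookup ?F \<beta> \<in> polys I"
      using lookup_separate_polys[OF assms, of Z \<beta>] by (rule polys_mono[rotated]) auto
  qed
  finally show ?thesis .
qed

section \<open>Normal forms in the terminal variables and a basis over them\<close>

definition reduced_polys :: "(nat \<times> nat, 'k) mpoly set" where
  "reduced_polys = {f. keys f \<subseteq> reduced}"

lemma reduced_polys_0: "0 \<in> reduced_polys"
  by (simp add: reduced_polys_def)

lemma reduced_polys_diff: "f \<in> reduced_polys \<Longrightarrow> g \<in> reduced_polys \<Longrightarrow> f - g \<in> reduced_polys"
  using keys_diff[of f g] by (auto simp: reduced_polys_def in_keys_iff lookup_minus)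

lemma reduced_polys_polys: "f \<in> reduced_polys \<Longrightarrow> f \<in> polys Z"
  by (auto simp: reduced_polys_def reduced_def mem_polys_iff)

lemma reduced_polys_sum_single:
  "A \<subseteq> reduced \<Longrightarrow> (\<Sum>\<beta>\<in>A. single \<beta> (c \<beta>)) \<in> reduced_polys"
proof (induction A rule: infinite_finite_induct)
  case (insert \<beta> A)
  then show ?case using keys_add[of "single \<beta> (c \<beta>)" "\<Sum>\<beta>\<in>A. single \<beta> (c \<beta>)"]
    by (auto simp: reduced_polys_def split: if_splits)
qed (simp_all add: reduced_polys_0)

lemma lookup_separate_polys_Z:
  fixes f :: "(nat \<times> nat, 'k) mpoly"
  assumes "f \<in> polys Z"
  shows "lookup (separate Z f) \<beta> = Const (lookup f \<beta>)"
proof -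
  have "separate Z f = peval (\<lambda>c. Const (Const c)) Var f"
    unfolding separate_def by (rule peval_cong) (use assms in \<open>auto simp: mem_polys_iff\<close>)
  then show ?thesis by (simp add: lookup_peval_Const_Var[OF ring_map_Const])
qed

lemma reduced_polys_mod_H:
  assumes "f \<in> polys Z"
  obtains g where "g \<in> reduced_polys" "f - g \<in> H"
proof -
  let ?F = "separate Z f"
  have f: "f \<in> polys I" using Z_I assms by (rule polys_mono)
  have "(\<Sum>\<beta>\<in>keys ?F \<inter> reduced. lookup ?F \<beta> * monom_eval Var \<beta>) =
      (\<Sum>\<beta>\<in>keys ?F \<inter> reduced. single \<beta> (lookup f \<beta>))"
    by (simp add: lookup_separate_polys_Z[OF assms] single_eq_Const_monom)
  then show thesis
    using that[OF reduced_polys_sum_single[of "keys ?F \<inter> reduced" "lookup f"]] reduce_mod_H[OF f] by simp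
qed

text \<open>The separated coefficients of such an \<open>f\<close> are constants; at reduced
  exponents they lie in \<open>H\<close>, hence are 0. This is the linear independence of the
  reduced monomials modulo \<open>H\<close>.\<close>

lemma polys_Z_in_H:
  assumes "f \<in> polys Z" "f \<in> H" "m \<in> keys f"
  shows "m \<notin> reduced"
  using separate_H_vanishing[OF assms(2)] assms(3)
  by (auto simp: vanishing_def lookup_separate_polys_Z[OF assms(1)] Const_in_H_iff in_keys_iff)

text \<open>\<open>B\<close> is a vector space basis of the polynomials in the other variables
  modulo those in \<open>H\<close>. It generates because the coefficients of \<open>f\<close> can be
  expanded one by one; it is independent because the reduced coefficients of an element of
  \<open>H\<close> are again in \<open>H\<close>.\<close>

lemma free_basis:
  obtains B where "B \<subseteq> polys I"
    and "\<And>f. f \<in> polys I \<Longrightarrow> \<exists>F a. finite F \<and> F \<subseteq> B \<and> (\<forall>b. a b \<in> reduced_polys) \<and>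
      f - (\<Sum>b\<in>F. a b * b) \<in> H"
    and "\<And>F a b. finite F \<Longrightarrow> F \<subseteq> B \<Longrightarrow> (\<And>b. b \<in> F \<Longrightarrow> a b \<in> reduced_polys) \<Longrightarrow>
      (\<Sum>b\<in>F. a b * b) \<in> H \<Longrightarrow> b \<in> F \<Longrightarrow> a b = 0"
proof -
  interpret vs: vector_space "\<lambda>(c::'k) (f :: (nat \<times> nat, 'k) mpoly). Const c * f"
    by (rule vector_space_Const)
  let ?U = "polys (I - Z) :: (nat \<times> nat, 'k) mpoly set"
  have U_I: "f \<in> ?U \<Longrightarrow> f \<in> polys I" for f by (rule polys_mono[rotated]) auto
  have sU: "vs.subspace ?U" by (rule vs.subspaceI) (auto intro: polys_add polys_mult)
  have sW: "vs.subspace (H \<inter> ?U)"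
    by (rule vs.subspaceI) (auto simp: H_0 intro: polys_add polys_mult H_add H_mult)
  show thesis
  proof (rule vs.basis_mod_subspace[OF sU sW Int_lower2])
    fix B
    assume B: "B \<subseteq> ?U"
      and span: "\<And>u. u \<in> ?U \<Longrightarrow> \<exists>F c. finite F \<and> F \<subseteq> B \<and> u - (\<Sum>b\<in>F. Const (c b) * b) \<in> H \<inter> ?U"
      and indep: "\<And>F c b. finite F \<Longrightarrow> F \<subseteq> B \<Longrightarrow> (\<Sum>b\<in>F. Const (c b) * b) \<in> H \<inter> ?U \<Longrightarrow> b \<in> F \<Longrightarrow> c b = 0"
    show thesis
    proof (rule that[of B])
      show "B \<subseteq> polys I" using B U_I by auto
    next
      fix f :: "(nat \<times> nat, 'k) mpoly" assume f: "f \<in> polys I"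
      let ?F = "separate Z f"
      let ?K = "keys ?F \<inter> reduced"
      define P where "P \<beta> F c \<longleftrightarrow> finite F \<and> F \<subseteq> B \<and> lookup ?F \<beta> - (\<Sum>b\<in>F. Const (c b) * b) \<in> H"
        for \<beta> F c
      have "\<exists>F c. P \<beta> F c" for \<beta>
        using span[OF lookup_separate_polys[OF f, of Z \<beta>]] unfolding P_def by blast
      then obtain F c where "\<And>\<beta>. P \<beta> (F \<beta>) (c \<beta>)" by metis
      then have Fc: "\<And>\<beta>. finite (F \<beta>)" "\<And>\<beta>. F \<beta> \<subseteq> B"
        "\<And>\<beta>. lookup ?F \<beta> - (\<Sum>b\<in>F \<beta>. Const (c \<beta> b) * b) \<in> H"
        unfolding P_def by auto
      define F' where "F' = (\<Union>\<beta>\<in>?K. F \<beta>)"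
      \<comment> \<open>Regroups the expansions of the separated coefficients: \<open>a b\<close>
        collects, over all \<open>\<beta>\<close>, the scalars in front of \<open>b\<close>.\<close>
      define a where "a b = (\<Sum>\<beta>\<in>?K. single \<beta> (if b \<in> F \<beta> then c \<beta> b else 0))" for b
      have F': "finite F'" "F' \<subseteq> B" unfolding F'_def using Fc(1,2) by auto
      have a: "a b \<in> reduced_polys" for b unfolding a_def by (rule reduced_polys_sum_single) auto
      have "(\<Sum>b\<in>F'. a b * b) =
          (\<Sum>\<beta>\<in>?K. (\<Sum>b\<in>F'. Const (if b \<in> F \<beta> then c \<beta> b else 0) * b) * monom_eval Var \<beta>)"
        unfolding a_def sum_distrib_right single_eq_Const_monom by (subst sum.swap) (simp add: mult_ac)
      also have "\<dots> = (\<Sum>\<beta>\<in>?K. (\<Sum>b\<in>F \<beta>. Const (c \<beta> b) * b) * monom_eval Var \<beta>)"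
      proof (rule sum.cong[OF refl], rule arg_cong2[where f = "(*)", OF _ refl])
        fix \<beta> assume "\<beta> \<in> ?K"
        then have "F \<beta> \<subseteq> F'" unfolding F'_def by auto
        then show "(\<Sum>b\<in>F'. Const (if b \<in> F \<beta> then c \<beta> b else 0) * b) = (\<Sum>b\<in>F \<beta>. Const (c \<beta> b) * b)"
          using F'(1) by (intro sum.mono_neutral_cong_right) auto
      qed
      finally have sum_a: "(\<Sum>b\<in>F'. a b * b) =
          (\<Sum>\<beta>\<in>?K. (\<Sum>b\<in>F \<beta>. Const (c \<beta> b) * b) * monom_eval Var \<beta>)" .
      have "(\<Sum>\<beta>\<in>?K. monom_eval Var \<beta> * (lookup ?F \<beta> - (\<Sum>b\<in>F \<beta>. Const (c \<beta> b) * b))) \<in> H"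
      proof (intro H_sum H_mult Fc(3) polys_monom_eval polys_Var)
        fix \<beta> x assume "\<beta> \<in> ?K" "x \<in> keys \<beta>"
        then show "x \<in> I" using Z_I by (auto simp: reduced_def)
      qed
      also have "(\<Sum>\<beta>\<in>?K. monom_eval Var \<beta> * (lookup ?F \<beta> - (\<Sum>b\<in>F \<beta>. Const (c \<beta> b) * b))) =
          (\<Sum>\<beta>\<in>?K. lookup ?F \<beta> * monom_eval Var \<beta>) - (\<Sum>b\<in>F'. a b * b)"
        unfolding sum_a by (simp add: right_diff_distrib sum_subtractf mult.commute)
      finally have "f - (\<Sum>b\<in>F'. a b * b) \<in> H"
        using H_add[OF reduce_mod_H[OF f]] by fastforce
      then show "\<exists>F a. finite F \<and> F \<subseteq> B \<and> (\<forall>b. a b \<in> reduced_polys) \<and> f - (\<Sum>b\<in>F. a b * b) \<in> H"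
        using F' a by blast
    next
      fix F a b
      assume F: "finite F" "F \<subseteq> B" "\<And>b. b \<in> F \<Longrightarrow> a b \<in> reduced_polys" "(\<Sum>b\<in>F. a b * b) \<in> H" "b \<in> F"
      have "lookup (a b) \<beta> = 0" for \<beta>
      proof (cases "\<beta> \<in> reduced")
        case True
        \<comment> \<open>Since no \<open>b\<close> involves a terminal variable, the coefficient of
          the sum at \<open>\<beta>\<close> is a scalar combination of the \<open>b\<close>.\<close>
        have "separate Z (\<Sum>b\<in>F. a b * b) = (\<Sum>b\<in>F. Const b * separate Z (a b))"
          using B F(2) by (auto simp: ring_map.sum[OF ring_map_separate] ring_map.mult[OF ring_map_separate]
              mult.commute intro!: sum.cong arg_cong2[where f = "(*)"] separate_eq_Const
              elim: polys_mono[rotated])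
        then have eq: "lookup (separate Z (\<Sum>b\<in>F. a b * b)) \<beta> = (\<Sum>b\<in>F. Const (lookup (a b) \<beta>) * b)"
          using F(3) by (simp add: lookup_sum lookup_Const_times lookup_separate_polys_Z reduced_polys_polys mult.commute)
        have "lookup (separate Z (\<Sum>b\<in>F. a b * b)) \<beta> \<in> H"
          using separate_H_vanishing[OF F(4)] True by (simp add: vanishing_def)
        then have "(\<Sum>b\<in>F. Const (lookup (a b) \<beta>) * b) \<in> H" unfolding eq .
        moreover have "(\<Sum>b\<in>F. Const (lookup (a b) \<beta>) * b) \<in> ?U"
          using F(2) B by (intro polys_sum polys_mult) auto
        ultimately show ?thesis using indep[of F "\<lambda>b. lookup (a b) \<beta>" b] F by simp
      next
        case False
        then show ?thesis using F(3)[OF F(5)] by (auto simp: reduced_polys_def in_keys_iff)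
      qed
      then show "a b = 0" by (intro poly_mapping_eqI) simp
    qed
  qed
qed

end

section \<open>The algebra of coinvariants\<close>

lemma finsum_regular_module: "finsum (regular_module R) = finsum R"
  by (intro ext) (simp add: finsum_def finprod_def regular_module_def)

lemma finsum_mpoly_ring:
  fixes g :: "'i \<Rightarrow> ('x, 'k::comm_ring_1) mpoly"
  assumes "\<And>i. i \<in> A \<Longrightarrow> g i \<in> polys I"
  shows "finsum (mpoly_ring I) g A = sum g A"
proof -
  interpret cring "mpoly_ring I :: ('x, 'k) mpoly ring" by (rule mpoly_ring_cring)
  show ?thesis using assms
  proof (induction A rule: infinite_finite_induct)
    case (insert i A)
    then show ?case by (subst finsum_insert) auto
  qed simp_all
qed

lemma nat_pow_mpoly_ring: "f [^]\<^bsub>mpoly_ring I\<^esub> (m::nat) = f ^ m"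
  by (induction m) (simp_all add: nat_pow_def mult.commute)

lemma diff_mpoly_ring:
  "f \<in> polys I \<Longrightarrow> g \<in> polys I \<Longrightarrow> f \<ominus>\<^bsub>mpoly_ring I\<^esub> g = f - g"
  by (simp add: a_minus_def minus_mpoly_ring)

context jordan_coinvariants
begin

abbreviation "R \<equiv> mpoly_ring I :: (nat \<times> nat, 'k) mpoly ring"
abbreviation "Q \<equiv> R Quot H"
abbreviation "\<pi> f \<equiv> H +>\<^bsub>R\<^esub> f"
abbreviation "A \<equiv> generate_alg Q (\<lambda>c. \<pi> (Const c)) ((\<lambda>i. \<pi> (Var (terminal i))) ` {..k})"

lemma \<pi>_hom: "ring_hom_cring R Q (\<lambda>f. \<pi> f)"
  by (rule ideal.rcos_ring_hom_cring[OF H_ideal mpoly_ring_cring])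

lemma \<pi>_ring_hom: "(\<lambda>f. \<pi> f) \<in> ring_hom R Q"
  by (rule ideal.rcos_ring_hom[OF H_ideal])

lemma Q_cring: "cring Q"
  by (rule ideal.quotient_is_cring[OF H_ideal mpoly_ring_cring])

lemma \<pi>_eq_iff:
  "f \<in> polys I \<Longrightarrow> g \<in> polys I \<Longrightarrow> \<pi> f = \<pi> g \<longleftrightarrow> f - g \<in> H"
  using ring.quotient_eq_iff_same_a_r_cos[OF cring.axioms(1)[OF mpoly_ring_cring] H_ideal, of f g]
  by (simp add: diff_mpoly_ring)

lemma carrier_Q: "carrier Q = (\<lambda>f. \<pi> f) ` polys I"
  unfolding FactRing_def by (auto simp: A_RCOSETS_def')

lemma \<pi>_closed: "f \<in> polys I \<Longrightarrow> \<pi> f \<in> carrier Q"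
  unfolding carrier_Q by blast

lemma \<pi>_add: "f \<in> polys I \<Longrightarrow> g \<in> polys I \<Longrightarrow> \<pi> f \<oplus>\<^bsub>Q\<^esub> \<pi> g = \<pi> (f + g)"
  using ring_hom_add[OF \<pi>_ring_hom, of f g] by simp

lemma \<pi>_mult: "f \<in> polys I \<Longrightarrow> g \<in> polys I \<Longrightarrow> \<pi> f \<otimes>\<^bsub>Q\<^esub> \<pi> g = \<pi> (f * g)"
  using ring_hom_mult[OF \<pi>_ring_hom, of f g] by simp

lemma \<pi>_0: "\<zero>\<^bsub>Q\<^esub> = \<pi> 0"
  using ring_hom_cring.hom_zero[OF \<pi>_hom] by simp

lemma \<pi>_1: "\<one>\<^bsub>Q\<^esub> = \<pi> 1"
  using ring_hom_one[OF \<pi>_ring_hom] by simp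

lemma \<pi>_uminus: "f \<in> polys I \<Longrightarrow> \<ominus>\<^bsub>Q\<^esub> \<pi> f = \<pi> (- f)"
  using ring_hom_cring.hom_a_inv[OF \<pi>_hom, of f] by (simp add: minus_mpoly_ring)

lemma polys_Z_I: "f \<in> polys Z \<Longrightarrow> f \<in> polys I"
  using Z_I by (rule polys_mono)

lemma A_subring: "subring A Q"
  unfolding generate_alg_def
  using Z_I by (intro ring.generate_ring_is_subring cring.axioms(1) Q_cring) (auto intro!: \<pi>_closed polys_Var)

lemma A_eq: "A = (\<lambda>f. \<pi> f) ` polys Z"
proof (intro equalityI subsetI)
  fix y assume "y \<in> A"
  then show "y \<in> (\<lambda>f. \<pi> f) ` polys Z"
    unfolding generate_alg_def
  proof (induction rule: generate_ring.induct)
    case one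
    then show ?case by (simp add: \<pi>_1)
  next
    case (incl h)
    then show ?case by (auto intro: polys_Var)
  next
    case (a_inv h)
    then show ?case by (auto simp: \<pi>_uminus polys_Z_I intro!: imageI polys_uminus)
  next
    case (eng_add h1 h2)
    then show ?case by (auto simp: \<pi>_add polys_Z_I intro!: imageI polys_add)
  next
    case (eng_mult h1 h2)
    then show ?case by (auto simp: \<pi>_mult polys_Z_I intro!: imageI polys_mult)
  qed
next
  have "f \<in> polys Z \<and> \<pi> f \<in> A" if "f \<in> polys Z" for f
    using that
  proof (induction f rule: polys_induct)
    case (Const c)
    then show ?case unfolding generate_alg_def by (auto intro: generate_ring.incl)
  next
    case (Var x)
    then show ?case unfolding generate_alg_def by (auto intro: generate_ring.incl polys_Var)
  next
    case (add f g)
    then have "\<pi> f \<oplus>\<^bsub>Q\<^esub> \<pi> g \<in> A" unfolding generate_alg_def by (blast intro: generate_ring.eng_add)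
    then show ?case using add by (simp add: \<pi>_add polys_Z_I polys_add)
  next
    case (mult f g)
    then have "\<pi> f \<otimes>\<^bsub>Q\<^esub> \<pi> g \<in> A" unfolding generate_alg_def by (blast intro: generate_ring.eng_mult)
    then show ?case using mult by (simp add: \<pi>_mult polys_Z_I polys_mult)
  qed
  then show "y \<in> A" if "y \<in> (\<lambda>f. \<pi> f) ` polys Z" for y using that by auto
qed

lemma A_eq_reduced: "A = (\<lambda>f. \<pi> f) ` reduced_polys"
proof (intro equalityI subsetI)
  fix y assume "y \<in> A"
  then obtain f where f: "f \<in> polys Z" "y = \<pi> f" unfolding A_eq by auto
  obtain g where g: "g \<in> reduced_polys" "f - g \<in> H" using reduced_polys_mod_H[OF f(1)] .
  then have "y = \<pi> g" using f by (simp add: \<pi>_eq_iff polys_Z_I reduced_polys_polys)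
  then show "y \<in> (\<lambda>f. \<pi> f) ` reduced_polys" using g by auto
qed (auto simp: A_eq dest: reduced_polys_polys)

lemma A_Q: "A \<subseteq> carrier Q"
  unfolding A_eq carrier_Q using polys_Z_I by blast

lemma A_cring: "cring (Q\<lparr>carrier := A\<rparr>)"
  using ring.subcring_iff[OF cring.axioms(1)[OF Q_cring] A_Q] cring.subcringI'[OF Q_cring A_subring]
  by simp

lemma regular_module_A: "Module.module (Q\<lparr>carrier := A\<rparr>) (regular_module Q)"
proof -
  interpret cring Q by (rule Q_cring)
  have A: "x \<in> carrier Q" if "x \<in> A" for x using A_Q that by blast
  have "abelian_group (regular_module Q)"
    by (rule abelian_groupI) (auto simp: regular_module_def a_ac intro: l_neg)
  then show ?thesis
    by (intro moduleI A_cring) (auto simp: regular_module_def A l_distr r_distr m_assoc)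
qed

lemma finsum_\<pi>:
  assumes "\<And>i. i \<in> F \<Longrightarrow> g i \<in> polys I"
  shows "(\<Oplus>\<^bsub>Q\<^esub>i\<in>F. \<pi> (g i)) = \<pi> (\<Sum>i\<in>F. g i)"
proof -
  have "\<pi> (finsum R g F) = finsum Q ((\<lambda>f. \<pi> f) \<circ> g) F"
    using assms by (intro ring_hom_cring.hom_finsum[OF \<pi>_hom]) auto
  then show ?thesis using assms by (simp add: finsum_mpoly_ring comp_def)
qed

text \<open>This is \<open>free_basis\<close> passed to the quotient. The work lies in
  \<open>module_basis\<close> asking for unique coefficient functions on residue classes, with
  values in \<open>A\<close> instead of chosen representatives.\<close>

lemma free_module_A: "free_module (Q\<lparr>carrier := A\<rparr>) (regular_module Q)"
proof -
  interpret Q: cring Q by (rule Q_cring)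
  show ?thesis
  proof (rule free_basis)
    fix B
    assume B: "B \<subseteq> polys I"
      and span: "\<And>f. f \<in> polys I \<Longrightarrow> \<exists>F a. finite F \<and> F \<subseteq> B \<and> (\<forall>b. a b \<in> reduced_polys) \<and>
        f - (\<Sum>b\<in>F. a b * b) \<in> H"
      and indep: "\<And>F a b. finite F \<Longrightarrow> F \<subseteq> B \<Longrightarrow> (\<And>b. b \<in> F \<Longrightarrow> a b \<in> reduced_polys) \<Longrightarrow>
        (\<Sum>b\<in>F. a b * b) \<in> H \<Longrightarrow> b \<in> F \<Longrightarrow> a b = 0"
    have red: "f \<in> polys I" if "f \<in> reduced_polys" for f
      using that by (intro polys_Z_I reduced_polys_polys)
    have "0 \<in> reduced" by (simp add: reduced_def prime_gt_0_nat[OF prime_p])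
    then have one: "1 \<in> reduced_polys" by (simp add: reduced_polys_def)
    \<comment> \<open>Equal classes would give a relation with coefficients 1 and -1, against
      \<open>indep\<close>; so \<open>B\<close> may be identified with its image.\<close>
    have inj: "inj_on (\<lambda>f. \<pi> f) B"
    proof (rule inj_onI, rule ccontr)
      fix b b' assume b: "b \<in> B" "b' \<in> B" "\<pi> b = \<pi> b'" "b \<noteq> b'"
      let ?a = "\<lambda>c. if c = b then 1 else - 1 :: (nat \<times> nat, 'k) mpoly"
      have "- 1 \<in> reduced_polys" using one by (simp add: reduced_polys_def)
      moreover have "b - b' \<in> H" using b B \<pi>_eq_iff[of b b'] by blast
      then have "(\<Sum>c\<in>{b, b'}. ?a c * c) \<in> H" using b by simp
      ultimately have "?a b = 0" using b one by (intro indep[of "{b, b'}" ?a b]) auto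
      then show False by simp
    qed
    let ?B = "(\<lambda>f. \<pi> f) ` B"
    let ?S = "\<lambda>c. {y \<in> ?B. c y \<noteq> \<zero>\<^bsub>Q\<^esub>}"
    \<comment> \<open>\<open>F\<close> may exceed the support of \<open>c\<close>; the additional
      terms are 0.\<close>
    have comb: "(\<Oplus>\<^bsub>Q\<^esub>y\<in>?S c. c y \<otimes>\<^bsub>Q\<^esub> y) = \<pi> (\<Sum>b\<in>F. a b * b)"
      if F: "finite F" "F \<subseteq> B" "?S c \<subseteq> (\<lambda>f. \<pi> f) ` F"
        and a: "\<And>b. b \<in> F \<Longrightarrow> a b \<in> reduced_polys" "\<And>b. b \<in> F \<Longrightarrow> c (\<pi> b) = \<pi> (a b)" for c F a
    proof -
      have c: "c y \<in> carrier Q" "y \<in> carrier Q" if "y \<in> (\<lambda>f. \<pi> f) ` F" for y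
        using that F(2) B a red by (auto intro!: \<pi>_closed)
      have "(\<Oplus>\<^bsub>Q\<^esub>y\<in>?S c. c y \<otimes>\<^bsub>Q\<^esub> y) = (\<Oplus>\<^bsub>Q\<^esub>y\<in>(\<lambda>f. \<pi> f) ` F. c y \<otimes>\<^bsub>Q\<^esub> y)"
        using F c by (intro Q.add.finprod_mono_neutral_cong_left) auto
      also have "\<dots> = (\<Oplus>\<^bsub>Q\<^esub>b\<in>F. c (\<pi> b) \<otimes>\<^bsub>Q\<^esub> \<pi> b)"
        using c F(2) by (intro Q.finsum_reindex inj_on_subset[OF inj]) auto
      also have "\<dots> = (\<Oplus>\<^bsub>Q\<^esub>b\<in>F. \<pi> (a b * b))"
        using F(2) B a red by (intro Q.finsum_cong') (auto simp: \<pi>_mult intro!: \<pi>_closed polys_mult)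
      also have "\<dots> = \<pi> (\<Sum>b\<in>F. a b * b)"
        using F(2) B a red by (intro finsum_\<pi> polys_mult) auto
      finally show ?thesis .
    qed
    have "\<exists>!c. c \<in> ?B \<rightarrow>\<^sub>E A \<and> finite (?S c) \<and> y = (\<Oplus>\<^bsub>Q\<^esub>y\<in>?S c. c y \<otimes>\<^bsub>Q\<^esub> y)"
      (is "\<exists>!c. ?P c") if y: "y \<in> carrier Q" for y
    proof (rule ex_ex1I)
      obtain f where f: "f \<in> polys I" "y = \<pi> f" using y unfolding carrier_Q by auto
      obtain F a where F: "finite F" "F \<subseteq> B" "\<And>b. a b \<in> reduced_polys" "f - (\<Sum>b\<in>F. a b * b) \<in> H"
        using span[OF f(1)] by auto
      define c where "c = (\<lambda>y\<in>?B. if y \<in> (\<lambda>f. \<pi> f) ` F then \<pi> (a (inv_into B (\<lambda>f. \<pi> f) y)) else \<zero>\<^bsub>Q\<^esub>)"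
      have S: "?S c \<subseteq> (\<lambda>f. \<pi> f) ` F" by (auto simp: c_def)
      have "\<zero>\<^bsub>Q\<^esub> \<in> A" unfolding A_eq_reduced using reduced_polys_0 by (auto simp: \<pi>_0)
      moreover have "\<pi> (a b) \<in> A" for b unfolding A_eq_reduced using F(3) by blast
      ultimately have "c \<in> ?B \<rightarrow>\<^sub>E A" by (intro PiE_I) (simp_all add: c_def restrict_def)
      moreover have "finite (?S c)" by (rule finite_subset[OF S finite_imageI[OF F(1)]])
      moreover have "y = (\<Oplus>\<^bsub>Q\<^esub>y\<in>?S c. c y \<otimes>\<^bsub>Q\<^esub> y)"
      proof -
        have "c (\<pi> b) = \<pi> (a b)" if "b \<in> F" for b
          using that F(2) inv_into_f_f[OF inj, of b] by (auto simp: c_def)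
        then have "(\<Oplus>\<^bsub>Q\<^esub>y\<in>?S c. c y \<otimes>\<^bsub>Q\<^esub> y) = \<pi> (\<Sum>b\<in>F. a b * b)"
          using F S by (intro comb) auto
        moreover have "(\<Sum>b\<in>F. a b * b) \<in> polys I"
          using F(2,3) B red by (intro polys_sum polys_mult) auto
        ultimately show ?thesis using f F(4) by (simp add: \<pi>_eq_iff)
      qed
      ultimately show "\<exists>c. ?P c" by blast
    next
      fix c c' assume c: "?P c" and c': "?P c'"
      have cA: "c \<in> ?B \<rightarrow>\<^sub>E A" "c' \<in> ?B \<rightarrow>\<^sub>E A"
        and c_fin: "finite (?S c)" "finite (?S c')"
        and c_y: "(\<Oplus>\<^bsub>Q\<^esub>y\<in>?S c. c y \<otimes>\<^bsub>Q\<^esub> y) = y" "(\<Oplus>\<^bsub>Q\<^esub>y\<in>?S c'. c' y \<otimes>\<^bsub>Q\<^esub> y) = y"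
        using c c' by (simp_all only: simp_thms)
      \<comment> \<open>Covers the supports of both \<open>c\<close> and \<open>c'\<close>, so that
        the two expansions of \<open>y\<close> can be subtracted termwise.\<close>
      let ?F = "{b \<in> B. \<pi> b \<in> ?S c \<union> ?S c'}"
      have fin: "finite ?F"
      proof (rule finite_imageD)
        show "finite ((\<lambda>f. \<pi> f) ` ?F)"
          by (rule finite_subset[of _ "?S c \<union> ?S c'"]) (use c_fin in auto)
        show "inj_on (\<lambda>f. \<pi> f) ?F" by (rule inj_on_subset[OF inj]) auto
      qed
      have F_B: "?F \<subseteq> B" by blast
      have F_S: "?S c \<subseteq> (\<lambda>f. \<pi> f) ` ?F" "?S c' \<subseteq> (\<lambda>f. \<pi> f) ` ?F" by blast+
      have ex: "\<exists>a. \<forall>b\<in>B. a b \<in> reduced_polys \<and> d (\<pi> b) = \<pi> (a b)" if "d \<in> ?B \<rightarrow>\<^sub>E A" for d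
      proof -
        have "\<forall>b\<in>B. \<exists>a. a \<in> reduced_polys \<and> d (\<pi> b) = \<pi> a"
          using that unfolding A_eq_reduced by (auto simp: PiE_def Pi_def)
        then show ?thesis by (rule bchoice)
      qed
      obtain a where a: "\<And>b. b \<in> B \<Longrightarrow> a b \<in> reduced_polys" "\<And>b. b \<in> B \<Longrightarrow> c (\<pi> b) = \<pi> (a b)"
        using ex[OF cA(1)] by blast
      obtain a' where a': "\<And>b. b \<in> B \<Longrightarrow> a' b \<in> reduced_polys" "\<And>b. b \<in> B \<Longrightarrow> c' (\<pi> b) = \<pi> (a' b)"
        using ex[OF cA(2)] by blast
      have e1: "\<pi> (\<Sum>b\<in>?F. a b * b) = y"
        by (subst c_y(1)[symmetric], rule comb[OF fin F_B F_S(1), symmetric]) (simp_all add: a)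
      have e2: "\<pi> (\<Sum>b\<in>?F. a' b * b) = y"
        by (subst c_y(2)[symmetric], rule comb[OF fin F_B F_S(2), symmetric]) (simp_all add: a')
      have F_I: "b \<in> polys I" if "b \<in> ?F" for b using that B by blast
      have p: "(\<Sum>b\<in>?F. a b * b) \<in> polys I" "(\<Sum>b\<in>?F. a' b * b) \<in> polys I"
        by (intro polys_sum polys_mult F_I red a(1) a'(1); blast)+
      have "(\<Sum>b\<in>?F. a b * b) - (\<Sum>b\<in>?F. a' b * b) \<in> H"
        by (rule iffD1[OF \<pi>_eq_iff[OF p] trans[OF e1 e2[symmetric]]])
      then have dH: "(\<Sum>b\<in>?F. (a b - a' b) * b) \<in> H"
        by (simp only: left_diff_distrib sum_subtractf)
      have eq: "a b - a' b = 0" if "b \<in> ?F" for b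
        by (rule indep[of ?F "\<lambda>b. a b - a' b" b, OF fin F_B _ dH that])
          (simp add: reduced_polys_diff a(1) a'(1))
      show "c = c'"
      proof (rule PiE_ext)
        show "c \<in> ?B \<rightarrow>\<^sub>E A" "c' \<in> ?B \<rightarrow>\<^sub>E A" by (rule cA)+
        fix z assume "z \<in> ?B"
        then obtain b where b: "b \<in> B" "z = \<pi> b" by auto
        show "c z = c' z"
        proof (cases "b \<in> ?F")
          case True
          then show ?thesis using eq[OF True] a(2) a'(2) b by simp
        next
          case False
          then show ?thesis using b by auto
        qed
      qed
    qed
    then have "module_basis (Q\<lparr>carrier := A\<rparr>) (regular_module Q) ?B"
      using B unfolding module_basis_def finsum_regular_module
      by (auto simp: regular_module_def intro!: \<pi>_closed)
    then show ?thesis using regular_module_A unfolding free_module_def by blast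
  qed
qed

section \<open>Presentation of the subalgebra by truncated polynomials\<close>

abbreviation "T \<equiv> mpoly_ring {..k} :: (nat, 'k) mpoly ring"
abbreviation "J \<equiv> Idl\<^bsub>T\<^esub> ((\<lambda>i. Var i ^ q i) ` {..k})"

text \<open>First isomorphism theorem for the map sending t_i to X_i. By \<open>polys_Z_in_H\<close>
  a polynomial in the terminal variables lies in \<open>H\<close> only if each of its monomials is
  divisible by some x_i^{q_i}, so the kernel is \<open>J\<close>.\<close>

lemma truncated_polynomials_isomorphic:
  "alg_isomorphic (Q\<lparr>carrier := A\<rparr>) (\<lambda>c. \<pi> (Const c)) (T Quot J) (\<lambda>c. J +>\<^bsub>T\<^esub> Const c)"
proof -
  interpret T: cring T by (rule mpoly_ring_cring)
  interpret Q: cring Q by (rule Q_cring)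
  define emb :: "(nat, 'k) mpoly \<Rightarrow> (nat \<times> nat, 'k) mpoly"
    where "emb = peval Const (\<lambda>i. Var (terminal i))"
  \<comment> \<open>Forgetting the position within the block inverts \<open>emb\<close> on
    polynomials in the terminal variables.\<close>
  define proj :: "(nat \<times> nat, 'k) mpoly \<Rightarrow> (nat, 'k) mpoly"
    where "proj = peval Const (\<lambda>x. Var (snd x))"
  interpret emb: ring_map emb unfolding emb_def by (rule ring_map.ring_map_peval[OF ring_map_Const])
  interpret proj: ring_map proj unfolding proj_def by (rule ring_map.ring_map_peval[OF ring_map_Const])
  have emb_simps: "emb (Const c) = Const c" "emb (Var i) = Var (terminal i)" for c i
    unfolding emb_def by (simp_all add: ring_map.peval_Const[OF ring_map_Const] ring_map.peval_Var[OF ring_map_Const])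
  have proj_simps: "proj (Const c) = Const c" "proj (Var x) = Var (snd x)" for c x
    unfolding proj_def by (simp_all add: ring_map.peval_Const[OF ring_map_Const] ring_map.peval_Var[OF ring_map_Const])
  have emb_polys: "emb g \<in> polys Z" if "g \<in> carrier T" for g
    unfolding emb_def using that by (rule polys_peval) (auto intro: polys_Var)
  have proj_emb: "proj (emb g) = g" for g
    by (rule ring_map_ext[OF ring_map_comp[OF proj.ring_map_axioms emb.ring_map_axioms] ring_map_ident, of UNIV])
      (simp_all add: emb_simps proj_simps mem_polys_iff)
  have proj_emb': "emb (proj f) = f" if "f \<in> polys Z" for f
    by (rule ring_map_ext[OF ring_map_comp[OF emb.ring_map_axioms proj.ring_map_axioms] ring_map_ident _ _ that])
      (auto simp: emb_simps proj_simps)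
  have proj_polys: "proj f \<in> carrier T" if "f \<in> polys Z" for f
    unfolding proj_def using that by (rule polys_peval) (auto intro: polys_Var)
  define \<psi> where "\<psi> g = \<pi> (emb g)" for g
  have \<psi>_hom: "ring_hom_ring T Q \<psi>"
    by (rule ring_hom_ringI)
      (auto simp: \<psi>_def \<pi>_mult \<pi>_add \<pi>_1 emb_polys polys_Z_I T.ring_axioms Q.ring_axioms intro!: \<pi>_closed)
  interpret \<psi>: ring_hom_ring T Q \<psi> by (rule \<psi>_hom)
  have image: "\<psi> ` carrier T = A"
    unfolding A_eq
  proof (intro equalityI subsetI)
    fix y assume "y \<in> (\<lambda>f. \<pi> f) ` polys Z"
    then obtain f where f: "f \<in> polys Z" "y = \<pi> f" by blast
    then have "y = \<psi> (proj f)" by (simp add: \<psi>_def proj_emb')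
    then show "y \<in> \<psi> ` carrier T" using proj_polys[OF f(1)] by blast
  qed (use emb_polys in \<open>auto simp: \<psi>_def\<close>)
  have J_sub: "(\<lambda>i. Var i ^ q i) ` {..k} \<subseteq> carrier T"
    by (auto intro!: polys_power polys_Var)
  have J_ideal: "ideal J T" using J_sub by (rule T.genideal_ideal)
  have J_mult: "f * g \<in> J" if "f \<in> carrier T" "g \<in> J" for f g
    using ideal.I_l_closed[OF J_ideal that(2,1)] by simp
  have J_sum: "sum g F \<in> J" if "\<And>i. i \<in> F \<Longrightarrow> g i \<in> J" for g :: "'i \<Rightarrow> _" and F
    using that
  proof (induction F rule: infinite_finite_induct)
    case (insert i F)
    then show ?case using additive_subgroup.a_closed[OF ideal.axioms(1)[OF J_ideal], of "g i" "sum g F"] by simp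
  qed (use additive_subgroup.zero_closed[OF ideal.axioms(1)[OF J_ideal]] in simp_all)
  have kernel_iff: "g \<in> a_kernel T Q \<psi> \<longleftrightarrow> g \<in> carrier T \<and> emb g \<in> H" for g
    using \<pi>_eq_iff[of "emb g" 0] emb_polys[of g]
    by (auto simp: a_kernel_def' \<psi>_def \<pi>_0 polys_Z_I)
  have "a_kernel T Q \<psi> = J"
  proof (intro equalityI subsetI)
    fix g assume g: "g \<in> a_kernel T Q \<psi>"
    then have gT: "g \<in> carrier T" and gH: "emb g \<in> H" by (simp_all add: kernel_iff)
    have "g = proj (\<Sum>m\<in>keys (emb g). single m (lookup (emb g) m))"
      by (simp add: proj_emb flip: poly_mapping_sum_single)
    also have "\<dots> = (\<Sum>m\<in>keys (emb g). proj (single m (lookup (emb g) m)))" by (rule proj.sum)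
    also have "\<dots> \<in> J"
    proof (rule J_sum)
      fix m assume m: "m \<in> keys (emb g)"
      then have keys: "keys m \<subseteq> Z" using emb_polys[OF gT] by (auto simp: mem_polys_iff)
      have "m \<notin> reduced" by (rule polys_Z_in_H[OF emb_polys[OF gT] gH m])
      with keys obtain i \<gamma> where i: "i \<le> k" "m = \<gamma> + single (terminal i) (q i)"
        by (rule not_reduced_split)
      let ?f = "single \<gamma> (lookup (emb g) m)"
      have "single m (lookup (emb g) m) = ?f * Var (terminal i) ^ q i"
        by (simp add: Var_power_eq mult_single i(2))
      then have "proj (single m (lookup (emb g) m)) = proj ?f * Var i ^ q i"
        by (simp add: proj_simps)
      moreover have "?f \<in> polys Z" using keys by (intro polys_single) (simp add: i(2) keys_add_nat)
      moreover have "Var i ^ q i \<in> J" using T.genideal_self[OF J_sub] i(1) by auto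
      ultimately show "proj (single m (lookup (emb g) m)) \<in> J"
        by (simp add: J_mult proj_polys)
    qed
    finally show "g \<in> J" .
  next
    have "J \<subseteq> a_kernel T Q \<psi>"
    proof (rule T.genideal_minimal)
      show "ideal (a_kernel T Q \<psi>) T" by (rule \<psi>.kernel_is_ideal)
      show "(\<lambda>i. Var i ^ q i) ` {..k} \<subseteq> a_kernel T Q \<psi>"
      proof (rule image_subsetI)
        fix i assume "i \<in> {..k}"
        then have "Var i ^ q i \<in> carrier T" "emb (Var i ^ q i) \<in> H"
          using J_sub terminal_power_in_H[of i] by (auto simp: emb_simps)
        then show "Var i ^ q i \<in> a_kernel T Q \<psi>" by (simp add: kernel_iff)
      qed
    qed
    then show "g \<in> a_kernel T Q \<psi>" if "g \<in> J" for g using that by blast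
  qed
  then have iso: "(\<lambda>Y. the_elem (\<psi> ` Y)) \<in> ring_iso (T Quot J) (Q\<lparr>carrier := A\<rparr>)"
    using \<psi>.FactRing_iso_set_aux by (simp add: image)
  have TJ: "ring (T Quot J)" by (rule ideal.quotient_is_ring[OF J_ideal])
  \<comment> \<open>The isomorphism theorem yields the map from the quotient to the subalgebra; the
    claim asks for the opposite direction.\<close>
  let ?h = "inv_into (carrier (T Quot J)) (\<lambda>Y. the_elem (\<psi> ` Y))"
  have "?h (\<pi> (Const c)) = J +>\<^bsub>T\<^esub> Const c" for c
  proof -
    have "the_elem (\<psi> ` (J +>\<^bsub>T\<^esub> Const c)) = \<psi> (Const c)"
      using \<psi>.the_elem_simp[of "Const c"] \<open>a_kernel T Q \<psi> = J\<close> by simp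
    then have e: "the_elem (\<psi> ` (J +>\<^bsub>T\<^esub> Const c)) = \<pi> (Const c)" by (simp add: \<psi>_def emb_simps)
    have mem: "J +>\<^bsub>T\<^esub> Const c \<in> carrier (T Quot J)"
      by (auto simp: FactRing_def A_RCOSETS_def')
    have inj: "inj_on (\<lambda>Y. the_elem (\<psi> ` Y)) (carrier (T Quot J))"
      using iso by (auto simp: ring_iso_def bij_betw_def)
    show ?thesis by (rule inv_into_f_eq[OF inj mem e])
  qed
  moreover have "?h \<in> ring_iso (Q\<lparr>carrier := A\<rparr>) (T Quot J)"
    by (rule ring_iso_set_sym[OF TJ iso])
  ultimately show ?thesis unfolding alg_isomorphic_def by blast
qed

end

section \<open>Invariants of a cyclic group\<close>

locale linear_group_action =
  vector_space scale + group_action G UNIV \<rho>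
  for scale :: "'k::field \<Rightarrow> 'v::ab_group_add \<Rightarrow> 'v"
    and G :: "('g, 'h) monoid_scheme" and \<rho> :: "'g \<Rightarrow> 'v \<Rightarrow> 'v" +
  fixes I :: "'x set" and e :: "'x \<Rightarrow> 'v"
  assumes linear_\<rho>: "\<And>g. g \<in> carrier G \<Longrightarrow> Vector_Spaces.linear scale scale (\<rho> g)"
    and finite_I: "finite I" and inj_e: "inj_on e I"
    and independent_e: "\<not> dependent (e ` I)" and span_e: "span (e ` I) = UNIV"
begin

abbreviation "crd \<equiv> coord scale I e"
abbreviation "dual \<equiv> dual_act G scale \<rho> I e"
abbreviation "act \<equiv> poly_act G scale \<rho> I e"

lemma coord_expansion: "(\<Sum>d\<in>I. scale (crd d v) (e d)) = v"
  using sum_representation_eq[OF independent_e, of v "e ` I"] inj_e finite_I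
  by (simp add: span_e sum.reindex coord_def)

lemma coord_scale: "crd b (scale c v) = c * crd b v"
  unfolding coord_def using independent_e span_e by (subst representation_scale) auto

lemma coord_0: "crd b 0 = 0"
  unfolding coord_def using independent_e by (simp add: representation_zero)

lemma coord_sum: "crd b (sum v A) = (\<Sum>i\<in>A. crd b (v i))"
  by (induction A rule: infinite_finite_induct)
    (simp_all add: coord_0 coord_add[OF vector_space_axioms independent_e span_e])

text \<open>Expands the vector moved by the inverse of \<open>g\<close> in the basis before applying
  the inverse of \<open>h\<close>. Inversion reverses the factors and duality restores their order,
  which makes \<open>act\<close> a left action.\<close>

lemma coord_mult:
  assumes "g \<in> carrier G" "h \<in> carrier G"
  shows "crd b (\<rho> (inv\<^bsub>G\<^esub> (g \<otimes>\<^bsub>G\<^esub> h)) v) =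
    (\<Sum>d\<in>I. crd b (\<rho> (inv\<^bsub>G\<^esub> h) (e d)) * crd d (\<rho> (inv\<^bsub>G\<^esub> g) v))"
proof -
  interpret G: group G by (rule group_hom.axioms(1)[OF group_hom])
  interpret h: Vector_Spaces.linear scale scale "\<rho> (inv\<^bsub>G\<^esub> h)"
    using assms by (intro linear_\<rho>) simp
  let ?w = "\<rho> (inv\<^bsub>G\<^esub> g) v"
  have "\<rho> (inv\<^bsub>G\<^esub> (g \<otimes>\<^bsub>G\<^esub> h)) v = \<rho> (inv\<^bsub>G\<^esub> h) ?w"
    using assms composition_rule[of v "inv\<^bsub>G\<^esub> h" "inv\<^bsub>G\<^esub> g"] by (simp add: G.inv_mult_group)
  also have "\<dots> = \<rho> (inv\<^bsub>G\<^esub> h) (\<Sum>d\<in>I. scale (crd d ?w) (e d))"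
    by (simp add: coord_expansion)
  also have "\<dots> = (\<Sum>d\<in>I. scale (crd d ?w) (\<rho> (inv\<^bsub>G\<^esub> h) (e d)))"
    by (simp add: h.sum h.scale)
  finally show ?thesis by (simp add: coord_sum coord_scale mult.commute)
qed

lemma act_ring_map: "ring_map (act g)"
  unfolding poly_act_def poly_subst_eq_peval by (rule ring_map.ring_map_peval[OF ring_map_Const])

lemma act_Const: "act g (Const c) = Const c"
  unfolding poly_act_def poly_subst_eq_peval by (rule ring_map.peval_Const[OF ring_map_Const])

lemma act_Var: "act g (Var b) = dual g b"
  unfolding poly_act_def poly_subst_eq_peval by (rule ring_map.peval_Var[OF ring_map_Const])

lemma act_mult:
  assumes g: "g \<in> carrier G" "h \<in> carrier G" and f: "f \<in> polys I"
  shows "act (g \<otimes>\<^bsub>G\<^esub> h) f = act g (act h f)"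
proof (rule ring_map_ext[OF act_ring_map ring_map_comp[OF act_ring_map act_ring_map] _ _ f])
  fix b
  interpret C: ring_map "Const :: 'k \<Rightarrow> ('x, 'k) mpoly" by (rule ring_map_Const)
  interpret g: ring_map "act g :: ('x, 'k) mpoly \<Rightarrow> _" by (rule act_ring_map)
  have "act g (dual h b) = (\<Sum>d\<in>I. Const (crd b (\<rho> (inv\<^bsub>G\<^esub> h) (e d))) *
      (\<Sum>c\<in>I. Const (crd d (\<rho> (inv\<^bsub>G\<^esub> g) (e c))) * Var c))"
    by (simp add: dual_act_def[of _ _ _ _ _ h] g.sum act_Const act_Var) (simp add: dual_act_def)
  also have "\<dots> = (\<Sum>c\<in>I. \<Sum>d\<in>I. Const (crd b (\<rho> (inv\<^bsub>G\<^esub> h) (e d)) *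
      crd d (\<rho> (inv\<^bsub>G\<^esub> g) (e c))) * Var c)"
    unfolding sum_distrib_left by (subst sum.swap) (simp add: mult.assoc)
  also have "\<dots> = dual (g \<otimes>\<^bsub>G\<^esub> h) b"
    by (simp only: dual_act_def coord_mult[OF g] C.sum sum_distrib_right)
  finally show "act (g \<otimes>\<^bsub>G\<^esub> h) (Var b) = act g (act h (Var b))" by (simp add: act_Var)
qed (simp add: act_Const)

lemma act_one:
  assumes f: "f \<in> polys I" shows "act \<one>\<^bsub>G\<^esub> f = f"
proof (rule ring_map_ext[OF act_ring_map ring_map_ident _ _ f])
  interpret G: group G by (rule group_hom.axioms(1)[OF group_hom])
  fix b assume b: "b \<in> I"
  have "\<rho> \<one>\<^bsub>G\<^esub> v = v" for v using id_eq_one by (metis UNIV_I restrict_apply)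
  then have "dual \<one>\<^bsub>G\<^esub> b = (\<Sum>c\<in>I. if c = b then Var c else 0)"
    unfolding dual_act_def using coord_basis[OF vector_space_axioms inj_e independent_e b]
    by (intro sum.cong refl) simp
  then show "act \<one>\<^bsub>G\<^esub> (Var b) = Var b" using b finite_I by (simp add: act_Var)
qed (simp add: act_Const)

text \<open>Invariance passes along the inductive generation of the group; for the inverse of
  \<open>\<sigma>\<close> it results from applying that inverse to
  \<open>act \<sigma> f = f\<close>.\<close>

lemma invariants_generator:
  assumes \<sigma>: "\<sigma> \<in> carrier G" "generate G {\<sigma>} = carrier G"
  shows "invariants G scale \<rho> I e = {f \<in> polys I. act \<sigma> f = f}"
proof (intro equalityI subsetI)
  interpret G: group G by (rule group_hom.axioms(1)[OF group_hom])
  fix f assume "f \<in> {f \<in> polys I. act \<sigma> f = f}"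
  then have f: "f \<in> polys I" "act \<sigma> f = f" by auto
  have "g \<in> carrier G \<and> act g f = f" if "g \<in> generate G {\<sigma>}" for g
    using that
  proof (induction rule: generate.induct)
    case one
    then show ?case using act_one[OF f(1)] by simp
  next
    case (incl h)
    then show ?case using \<sigma> f by simp
  next
    case (inv h)
    have "act (inv\<^bsub>G\<^esub> \<sigma>) f = act (inv\<^bsub>G\<^esub> \<sigma>) (act \<sigma> f)" by (simp add: f)
    also have "\<dots> = act (inv\<^bsub>G\<^esub> \<sigma> \<otimes>\<^bsub>G\<^esub> \<sigma>) f" using \<sigma> f by (intro act_mult[symmetric]) simp_all
    also have "\<dots> = f" using \<sigma> f by (simp add: act_one)
    finally show ?case using inv \<sigma> by simp
  next
    case (eng h1 h2)
    then show ?case using f by (simp add: act_mult)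
  qed
  then show "f \<in> invariants G scale \<rho> I e" using f(1) \<sigma>(2) by (auto simp: invariants_def)
qed (use \<sigma> in \<open>auto simp: invariants_def\<close>)

end

text \<open>For the least m with n <= p^m, minimality gives p^(m-1) < n and monotonicity excludes
  larger exponents. Integer exponents matter for n = 1, where m = 0 and the bound reads p^(-1) <
  1.\<close>

lemma Greatest_powi_less:
  assumes p: "1 < p" and n: "1 \<le> n" "n \<le> p ^ r"
  shows "(GREATEST b. real n > real p powi (b - 1)) = int (LEAST m. n \<le> p ^ m)"
proof (rule Greatest_equality)
  let ?m = "LEAST m. n \<le> p ^ m"
  have m: "n \<le> p ^ ?m" using n(2) by (rule LeastI)
  show "real p powi (int ?m - 1) < real n"
  proof (cases ?m)
    case 0
    have "real p powi - 1 < 1" using p by (simp add: power_int_minus field_simps)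
    then show ?thesis using n 0 by simp
  next
    case (Suc l)
    then have "\<not> n \<le> p ^ l" by (intro not_less_Least) simp
    then have "real (p ^ l) < real n" by (simp only: of_nat_less_iff not_le)
    then show ?thesis by (simp add: Suc)
  qed
  fix b assume b: "real p powi (b - 1) < real n"
  show "b \<le> int ?m"
  proof (rule ccontr)
    assume "\<not> b \<le> int ?m"
    then have "real p powi int ?m \<le> real p powi (b - 1)"
      using p by (intro power_int_increasing) auto
    moreover have "real n \<le> real p powi int ?m" using m by (simp flip: of_nat_power)
    ultimately show False using b by linarith
  qed
qed

theorem proposition15:
  fixes p r k :: nat
    and n :: "nat \<Rightarrow> nat"
    and a :: "nat \<Rightarrow> int"
    and G :: "('g, 'h) monoid_scheme"
    and \<sigma> :: 'g
    and scale :: "'k::field \<Rightarrow> 'v::ab_group_add \<Rightarrow> 'v"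
    and \<rho> :: "'g \<Rightarrow> 'v \<Rightarrow> 'v"
    and e :: "nat \<times> nat \<Rightarrow> 'v"
  assumes "Factorial_Ring.prime p" and "CHAR('k) = p"
    and "group G" and "order G = p ^ r"
    and "\<sigma> \<in> carrier G" and "generate G {\<sigma>} = carrier G"
    and "\<And>i. i \<le> k \<Longrightarrow> 1 \<le> n i \<and> n i \<le> p ^ r"
    and "vector_space scale"
    and "group_action G UNIV \<rho>"
    and "\<And>g. g \<in> carrier G \<Longrightarrow> Vector_Spaces.linear scale scale (\<rho> g)"
    and "inj_on e (jordan_index k n)"
    and "\<not> module.dependent scale (e ` jordan_index k n)"
    and "module.span scale (e ` jordan_index k n) = UNIV"
    and "\<And>i j. \<lbrakk>i \<le> k; 1 \<le> j; j < n i\<rbrakk> \<Longrightarrow> \<rho> (inv\<^bsub>G\<^esub> \<sigma>) (e (j, i)) = e (j, i) + e (j + 1, i)"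
    and "\<And>i. i \<le> k \<Longrightarrow> \<rho> (inv\<^bsub>G\<^esub> \<sigma>) (e (n i, i)) = e (n i, i)"
    and "\<And>i. i \<le> k \<Longrightarrow> a i = (GREATEST b. real (n i) > real p powi (b - 1))"
  shows "let I = jordan_index k n;
             H = hilbert_ideal G scale \<rho> I e;
             Q = coinvariants G scale \<rho> I e;
             xbar = (\<lambda>i. H +>\<^bsub>mpoly_ring I\<^esub> Var (n i, i));
             \<iota> = (\<lambda>c. H +>\<^bsub>mpoly_ring I\<^esub> Const c);
             A = Q\<lparr>carrier := generate_alg Q \<iota> (xbar ` {..k})\<rparr>;
             T = (mpoly_ring {..k} :: (nat, 'k) mpoly ring);
             J = Idl\<^bsub>T\<^esub> ((\<lambda>i. Var i [^]\<^bsub>T\<^esub> (p ^ nat (a i))) ` {..k})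
         in alg_isomorphic A \<iota> (T Quot J) (\<lambda>c. J +>\<^bsub>T\<^esub> Const c) \<and>
            free_module A (regular_module Q)"
proof -
  let ?I = "jordan_index k n"
  let ?H = "hilbert_ideal G scale \<rho> ?I e"
  define \<alpha> where "\<alpha> i = (LEAST m. n i \<le> p ^ m)" for i
  interpret linear_group_action scale G \<rho> ?I e
    by (intro linear_group_action.intro linear_group_action_axioms.intro) (use assms in simp_all)
  \<comment> \<open>Agreement is claimed on \<open>polys ?I\<close> only, because
    \<open>dual_act_jordan\<close> computes the dual action for indices in
    \<open>?I\<close>.\<close>
  have "act \<sigma> f = jordan_map f" if "f \<in> polys ?I" for f
    unfolding poly_act_def poly_subst_eq_peval
  proof (rule peval_cong)
    fix m x assume "m \<in> keys f" "x \<in> keys m"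
    then have x: "x \<in> ?I" using that by (auto simp: mem_polys_iff)
    then show "dual \<sigma> x = jordan_var x"
      using dual_act_jordan[where \<rho> = \<rho> and \<sigma> = \<sigma> and G = G and n = n and j = "fst x" and i = "snd x",
          OF assms(8,11,12,13,14,15)]
      by (simp add: jordan_var_def)
  qed
  then have inv: "invariants G scale \<rho> ?I e = {f \<in> polys ?I. jordan_map f = f}"
    using invariants_generator[OF assms(5,6)] by auto
  interpret jordan_coinvariants p k r n \<alpha> ?H
  proof
    show "Factorial_Ring.prime p" "CHAR('k) = p" by fact+
    fix i assume i: "i \<le> k"
    show "1 \<le> n i" "n i \<le> p ^ r" using assms(7)[OF i] by auto
    then show "n i \<le> p ^ \<alpha> i" unfolding \<alpha>_def by (intro LeastI)
    show "p ^ s < n i" if "s < \<alpha> i" for s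
      using not_less_Least[OF that[unfolded \<alpha>_def]] by simp
  next
    show "?H = Idl\<^bsub>mpoly_ring ?I\<^esub> {f \<in> polys ?I. jordan_map f = f \<and> (\<exists>d>0. homogeneous d f)}"
      unfolding hilbert_ideal_def inv by (rule arg_cong[where f = "genideal _"]) auto
  qed
  have "nat (a i) = \<alpha> i" if "i \<le> k" for i
    using assms(7,16)[OF that] Greatest_powi_less[of p "n i" r] prime_gt_1_nat[OF assms(1)]
    by (simp add: \<alpha>_def)
  then have J: "(\<lambda>i. Var i [^]\<^bsub>T\<^esub> (p ^ nat (a i))) ` {..k} = (\<lambda>i. Var i ^ q i) ` {..k}"
    by (intro image_cong refl) (simp add: nat_pow_mpoly_ring)
  show ?thesis
    unfolding Let_def coinvariants_def J
    using truncated_polynomials_isomorphic free_module_A by blast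
qed

end
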